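(* Let $\mathfrak{o}$ be a norm-finite Dedekind domain, $U=\mathrm{GL}_2(\mathfrak{o})$, and let $A\in\mathfrak{o}^{2\times 2}$ with $\det A\neq 0$. Let $\mu(A)=|U\backslash UAU|$ be the number of right cosets $UB$ contained in the double coset $UAU$. Then $$\mu(A)=\mathrm{N}(\mathfrak{f}_2(A))\prod_{\substack{\mathfrak{p}\text{ prime ideal}\\ \mathfrak{p}\mid\mathfrak{f}_2(A)}}\bigl(1+\mathrm{N}(\mathfrak{p})^{-1}\bigr).$$
   Context: A Dedekind domain $\mathfrak{o}$ is called norm-finite if $|\mathfrak{o}/a\mathfrak{o}|<\infty$ for every nonzero $a\in\mathfrak{o}$. For a nonzero ideal $\mathfrak{a}$ of $\mathfrak{o}$, $\mathrm{N}(\mathfrak{a})=|\mathfrak{o}/\mathfrak{a}|$. For $A=\begin{pmatrix}a&b\\c&d\end{pmatrix}\in\mathfrak{o}^{2\times2}$ with $\det A\ne0$, put $\mathfrak{d}_1(A)=a\mathfrak{o}+b\mathfrak{o}+c\mathfrak{o}+d\mathfrak{o}$, $\mathfrak{d}_2(A)=(\det A)\mathfrak{o}$ and $\mathfrak{f}_2(A)=\mathfrak{d}_2(A)\mathfrak{d}_1(A)^{-2}$ (this is an ideal of $\mathfrak{o}$). Prime ideals are nonzero prime ideals of $\mathfrak{o}$, and $\mathfrak{p}\mid\mathfrak{a}$ means $\mathfrak{a}\subseteq\mathfrak{p}$. A right coset of $U$ is a set of the form $UB$. *)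

theory Defs
  imports
    "HOL-Analysis.Determinants"
    "HOL-Algebra.Algebra"
    "HOL-Algebra.Algebraic_Closure_Type"
    "HOL-Computational_Algebra.Polynomial_Factorial"
begin

text \<open>
  The domain is a type \<open>'a :: idom\<close>. Matrices over it are those of HOL-Analysis, its ideals are
  those of HOL-Algebra taken in \<^const>\<open>ring_of_type_algebra\<close>, the record whose carrier is the
  whole type, and its field of fractions is \<open>'a fract\<close>.
\<close>

definition integrally_closed_domain :: "'a::idom itself \<Rightarrow> bool" where
  "integrally_closed_domain _ \<longleftrightarrow>
     (\<forall>x :: 'a fract. (\<exists>p :: 'a poly. lead_coeff p = 1 \<and> poly (map_poly to_fract p) x = 0)
        \<longrightarrow> x \<in> range to_fract)"

text \<open>Fields count as Dedekind domains.\<close>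

definition dedekind_domain :: "'a::idom itself \<Rightarrow> bool" where
  "dedekind_domain T \<longleftrightarrow>
     noetherian_domain (ring_of_type_algebra :: 'a ring) \<and>
     integrally_closed_domain T \<and>
     (\<forall>P. primeideal P (ring_of_type_algebra :: 'a ring) \<and> P \<noteq> {0}
        \<longrightarrow> maximalideal P (ring_of_type_algebra :: 'a ring))"

definition norm_finite :: "'a::idom itself \<Rightarrow> bool" where
  "norm_finite _ \<longleftrightarrow>
     (\<forall>a :: 'a. a \<noteq> 0 \<longrightarrow>
        finite (carrier (ring_of_type_algebra Quot (PIdl\<^bsub>ring_of_type_algebra\<^esub> a))))"

definition ideal_norm :: "'a::idom set \<Rightarrow> nat" where
  "ideal_norm I = card (carrier (ring_of_type_algebra Quot I))"

definition prime_ideals_dividing :: "'a::idom set \<Rightarrow> 'a set set" where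
  "prime_ideals_dividing I = {P. primeideal P ring_of_type_algebra \<and> P \<noteq> {0} \<and> I \<subseteq> P}"

definition d1 :: "'a::idom ^ 2 ^ 2 \<Rightarrow> 'a set" where
  "d1 A = {A $ 1 $ 1 * w + A $ 1 $ 2 * x + A $ 2 $ 1 * y + A $ 2 $ 2 * z | w x y z. True}"

definition d2 :: "'a::idom ^ 2 ^ 2 \<Rightarrow> 'a set" where
  "d2 A = PIdl\<^bsub>ring_of_type_algebra\<^esub> (det A)"

text \<open>
  For fractional ideals \<open>I\<close> and \<open>J\<close>, closing the products \<open>x * y\<close> under addition, as
  \<^const>\<open>ideal_prod\<close> does, gives the fractional ideal \<open>I J\<close>.
\<close>

definition frac_mult :: "'a::idom fract set \<Rightarrow> 'a fract set \<Rightarrow> 'a fract set" where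
  "frac_mult I J = I \<cdot>\<^bsub>ring_of_type_algebra\<^esub> J"

definition frac_inverse :: "'a::idom set \<Rightarrow> 'a fract set" where
  "frac_inverse I = {x. \<forall>a\<in>I. x * to_fract a \<in> range to_fract}"

text \<open>
  \<open>d2 A * d1 A ^ (-2)\<close> as a fractional ideal; \<open>f2 A\<close> is the same object as a subset of the
  domain, see \<open>image_f2\<close> below.
\<close>

definition frac_f2 :: "'a::idom ^ 2 ^ 2 \<Rightarrow> 'a fract set" where
  "frac_f2 A =
     frac_mult (to_fract ` d2 A) (frac_mult (frac_inverse (d1 A)) (frac_inverse (d1 A)))"

definition f2 :: "'a::idom ^ 2 ^ 2 \<Rightarrow> 'a set" where
  "f2 A = {x. to_fract x \<in> frac_f2 A}"

definition GL2 :: "('a::idom ^ 2 ^ 2) set" where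
  "GL2 = {P. invertible P}"

definition GL2_right_coset :: "'a::idom ^ 2 ^ 2 \<Rightarrow> ('a ^ 2 ^ 2) set" where
  "GL2_right_coset B = {P ** B | P. P \<in> GL2}"

definition GL2_double_coset :: "'a::idom ^ 2 ^ 2 \<Rightarrow> ('a ^ 2 ^ 2) set" where
  "GL2_double_coset A = {P ** A ** Q | P Q. P \<in> GL2 \<and> Q \<in> GL2}"

definition mu :: "'a::idom ^ 2 ^ 2 \<Rightarrow> nat" where
  "mu A = card {C. (\<exists>B. C = GL2_right_coset B) \<and> C \<subseteq> GL2_double_coset A}"

lemma image_f2: "to_fract ` f2 A = frac_f2 A"
proof -
  let ?R = "range to_fract :: 'a fract set"
  let ?K = "ring_of_type_algebra :: 'a fract ring"
  let ?V = "frac_inverse (d1 A)"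
  have add: "x + y \<in> ?R" if "x \<in> ?R" "y \<in> ?R" for x y
    using that by (auto simp flip: to_fract_add)
  have mul: "x * y \<in> ?R" if "x \<in> ?R" "y \<in> ?R" for x y
    using that by (auto simp flip: to_fract_mult)
  have dif: "x - y \<in> ?R" if "x \<in> ?R" "y \<in> ?R" for x y
    using that by (auto simp flip: to_fract_diff)
  have lin: "A $ 1 $ 1 * w + A $ 1 $ 2 * x + A $ 2 $ 1 * y + A $ 2 $ 2 * z \<in> d1 A" for w x y z
    unfolding d1_def by blast
  have ent: "A $ 1 $ 1 \<in> d1 A" "A $ 1 $ 2 \<in> d1 A" "A $ 2 $ 1 \<in> d1 A" "A $ 2 $ 2 \<in> d1 A"
    using lin[of 1 0 0 0] lin[of 0 1 0 0] lin[of 0 0 1 0] lin[of 0 0 0 1] by simp_all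
  have det: "to_fract (det A) * (u * v) \<in> ?R" if "u \<in> ?V" "v \<in> ?V" for u v
  proof -
    have uv: "u * to_fract a \<in> ?R" "v * to_fract a \<in> ?R" if "a \<in> d1 A" for a
      using that \<open>u \<in> ?V\<close> \<open>v \<in> ?V\<close> by (auto simp: frac_inverse_def)
    have "to_fract (det A) * (u * v) =
        (u * to_fract (A $ 1 $ 1)) * (v * to_fract (A $ 2 $ 2)) -
        (u * to_fract (A $ 1 $ 2)) * (v * to_fract (A $ 2 $ 1))"
      by (simp add: det_2 algebra_simps)
    also have "\<dots> \<in> ?R" by (intro dif mul uv ent)
    finally show ?thesis .
  qed
  have *: "to_fract (det A) * s \<in> ?R" if "s \<in> frac_mult ?V ?V" for s
    using that unfolding frac_mult_def
    by (induction rule: ideal_prod.induct)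
       (auto simp: ring_of_type_algebra_def distrib_left intro!: det add)
  have "x \<in> ?R" if "x \<in> frac_f2 A" for x
    using that unfolding frac_f2_def frac_mult_def[of "to_fract ` d2 A"]
  proof (induction rule: ideal_prod.induct)
    case (prod i j)
    then obtain r where "i = to_fract r * to_fract (det A)"
      unfolding d2_def cgenideal_def ring_of_type_algebra_def by fastforce
    moreover have "to_fract r * (to_fract (det A) * j) \<in> ?R"
      using prod by (intro mul *) auto
    ultimately show ?case by (simp add: ring_of_type_algebra_def mult.assoc)
  next
    case (sum s1 s2)
    then show ?case by (auto simp: ring_of_type_algebra_def intro: add)
  qed
  then show ?thesis unfolding f2_def by blast
qed

end

theory Submission
  imports Defs
begin

text \<open>
  Write \<open>\<ff> = f2 A\<close> and let \<open>\<aa> = d1 A\<close>. The vectors \<open>u * r\<close> with \<open>u \<in> \<aa>\<^sup>-\<^sup>1\<close> and \<open>r\<close> a row of \<open>A\<close> span a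
  submodule of \<open>\<oo>\<^sup>2\<close> whose reduction modulo \<open>\<ff>\<close> is a line, spanned by one vector \<open>w\<close> that is
  unimodular modulo \<open>\<ff>\<close>. Since \<open>\<aa>\<close> is invertible, \<open>U A Q = U A Q'\<close> holds iff \<open>w Q\<close> and \<open>w Q'\<close> span the
  same line modulo \<open>\<ff>\<close>. As \<open>SL\<^sub>2(\<oo>)\<close> acts transitively on these lines, \<open>mu A\<close> is the number of points
  of the projective line over \<open>\<oo> / \<ff>\<close>, that is, the number of unimodular pairs divided by the number
  of units. By the Chinese remainder theorem these two numbers are
  \<open>N\<^sup>2 \<Prod>(1 - q\<^sup>-\<^sup>2)\<close> and \<open>N \<Prod>(1 - q\<^sup>-\<^sup>1)\<close>, with \<open>N = |\<oo> / \<ff>|\<close> and \<open>q = |\<oo> / \<pp>|\<close> for the primes \<open>\<pp>\<close> above \<open>\<ff>\<close>.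

  Invertibility of \<open>\<aa>\<close> uses the finiteness of the quotients: if a prime \<open>\<pp>\<close> contained \<open>\<aa> \<aa>\<^sup>-\<^sup>1\<close>, then, as
  \<open>\<pp>\<close> is the annihilator of some \<open>b\<close> modulo \<open>a \<in> \<aa>\<close>, all powers of \<open>x = b / a \<notin> \<oo>\<close> would lie in \<open>\<aa>\<^sup>-\<^sup>1\<close>,
  and \<open>x\<close> would be integral.
\<close>

no_notation fps_nth (infixl \<open>$\<close> 75)

section \<open>Counting cosets that avoid a family of subgroups\<close>

definition subgrp :: "'g::ab_group_add set \<Rightarrow> bool" where
  "subgrp S \<longleftrightarrow> 0 \<in> S \<and> (\<forall>x\<in>S. \<forall>y\<in>S. x - y \<in> S)"

text \<open>For a subgroup, the predicate under the choice depends only on the coset of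
  \<open>x\<close>, so congruent elements receive the same representative. Quotients are thereby
  handled as sets of elements, \<open>reps S\<close>.\<close>

definition rep :: "'g::ab_group_add set \<Rightarrow> 'g \<Rightarrow> 'g" where
  "rep S x = (SOME y. y - x \<in> S)"

definition reps :: "'g::ab_group_add set \<Rightarrow> 'g set" where
  "reps S = range (rep S)"

lemma subgrp_zero: "subgrp S \<Longrightarrow> 0 \<in> S"
  and subgrp_diff: "subgrp S \<Longrightarrow> x \<in> S \<Longrightarrow> y \<in> S \<Longrightarrow> x - y \<in> S"
  by (auto simp: subgrp_def)

lemma subgrp_minus: "subgrp S \<Longrightarrow> x \<in> S \<Longrightarrow> - x \<in> S"
  using subgrp_diff[of S 0 x] by (simp add: subgrp_zero)

lemma subgrp_add: "subgrp S \<Longrightarrow> x \<in> S \<Longrightarrow> y \<in> S \<Longrightarrow> x + y \<in> S"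
  using subgrp_diff[of S x "- y"] by (simp add: subgrp_minus)

lemma subgrp_sum: "subgrp S \<Longrightarrow> (\<And>i. i \<in> T \<Longrightarrow> f i \<in> S) \<Longrightarrow> sum f T \<in> S"
  by (induction T rule: infinite_finite_induct) (auto simp: subgrp_zero subgrp_add)

lemma subgrp_swap: "subgrp S \<Longrightarrow> x - y \<in> S \<longleftrightarrow> y - x \<in> S"
  using subgrp_minus[of S "x - y"] subgrp_minus[of S "y - x"] by auto

lemma subgrp_cong: "subgrp S \<Longrightarrow> x - y \<in> S \<Longrightarrow> x \<in> S \<longleftrightarrow> y \<in> S"
  using subgrp_add[of S "x - y" y] subgrp_diff[of S x "x - y"] by auto

lemma rep_diff: "subgrp S \<Longrightarrow> rep S x - x \<in> S"
  unfolding rep_def by (rule someI[of _ x]) (simp add: subgrp_zero)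

lemma rep_eq_iff: "subgrp S \<Longrightarrow> rep S x = rep S y \<longleftrightarrow> x - y \<in> S"
proof
  assume "subgrp S" and eq: "rep S x = rep S y"
  then have "(rep S x - y) - (rep S x - x) \<in> S"
    by (metis rep_diff subgrp_diff)
  then show "x - y \<in> S" by simp
next
  assume S: "subgrp S" and d: "x - y \<in> S"
  have "z - x \<in> S \<longleftrightarrow> z - y \<in> S" for z
    using subgrp_add[OF S _ d, of "z - x"] subgrp_diff[OF S _ d, of "z - y"] by auto
  then show "rep S x = rep S y" by (simp add: rep_def)
qed

lemma rep_idem: "subgrp S \<Longrightarrow> x \<in> reps S \<Longrightarrow> rep S x = x"
  unfolding reps_def using rep_diff rep_eq_iff by blast

lemma rep_mem: "rep S x \<in> reps S"
  by (simp add: reps_def)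

lemma reps_inj: "subgrp S \<Longrightarrow> x \<in> reps S \<Longrightarrow> y \<in> reps S \<Longrightarrow> x - y \<in> S \<Longrightarrow> x = y"
  by (metis rep_eq_iff rep_idem)

lemma rep_cong:
  assumes "subgrp S" "K \<subseteq> S" "subgrp K"
  shows "rep K x \<in> S \<longleftrightarrow> x \<in> S" "rep K x - y \<in> S \<longleftrightarrow> x - y \<in> S"
proof -
  have "rep K x - x \<in> S" using rep_diff[OF assms(3)] assms(2) by blast
  then show "rep K x \<in> S \<longleftrightarrow> x \<in> S" "rep K x - y \<in> S \<longleftrightarrow> x - y \<in> S"
    using subgrp_cong[OF assms(1)] by (auto simp: subgrp_cong[OF assms(1), of "rep K x - y" "x - y"])
qed

lemma finite_reps_mono:
  assumes "subgrp K" "subgrp S" "K \<subseteq> S" "finite (reps K)"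
  shows "finite (reps S)"
proof -
  have "rep S x = rep S (rep K x)" for x
    using rep_diff[OF assms(1), of x] assms(2,3) by (metis rep_eq_iff subgrp_swap subsetD)
  then have "reps S \<subseteq> rep S ` reps K" by (auto simp: reps_def)
  then show ?thesis using assms(4) finite_surj by blast
qed

text \<open>A subgroup containing \<open>K\<close> is a union of cosets of \<open>K\<close>, hence
  is recovered from the representatives it contains. This later yields maximal ideals, maximal
  annihilators and the finiteness of the set of primes above an ideal.\<close>

lemma finite_supergroups:
  assumes "subgrp K" "finite (reps K)"
  shows "finite {S. subgrp S \<and> K \<subseteq> S}"
proof (rule inj_on_finite[where f = "\<lambda>S. S \<inter> reps K"])
  show "inj_on (\<lambda>S. S \<inter> reps K) {S. subgrp S \<and> K \<subseteq> S}"
  proof (rule inj_onI)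
    fix S S' assume *: "S \<in> {S. subgrp S \<and> K \<subseteq> S}" "S' \<in> {S. subgrp S \<and> K \<subseteq> S}"
      "S \<inter> reps K = S' \<inter> reps K"
    have "x \<in> S \<longleftrightarrow> x \<in> S'" for x
      using * rep_cong(1)[of S K x] rep_cong(1)[of S' K x] rep_mem[of K x] assms by auto
    then show "S = S'" by blast
  qed
  show "(\<lambda>S. S \<inter> reps K) ` {S. subgrp S \<and> K \<subseteq> S} \<subseteq> Pow (reps K)" by auto
  show "finite (Pow (reps K))" using assms by simp
qed

lemma reps_pigeonhole:
  assumes "subgrp S" "finite (reps S)"
  obtains m n :: nat where "m < n" "f n - f m \<in> S"
proof -
  have "finite (range (\<lambda>n. rep S (f n)))"
    by (rule finite_subset[OF _ assms(2)]) (auto simp: reps_def)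
  then have "\<not> inj (\<lambda>n. rep S (f n))"
    using finite_imageD[of "\<lambda>n. rep S (f n)" UNIV] by auto
  then obtain m n where "m \<noteq> n" "rep S (f m) = rep S (f n)"
    by (auto simp: inj_def)
  then show thesis
    using that[of m n] that[of n m] rep_eq_iff[OF assms(1)] by (metis linorder_neqE_nat)
qed

lemma card_eq_fibres:
  assumes "finite W" "\<And>y. y \<in> g ` W \<Longrightarrow> card {x \<in> W. g x = y} = k"
  shows "card W = k * card (g ` W)"
proof -
  have "card W = (\<Sum>y\<in>g ` W. card {x \<in> W. g x = y})"
    using sum.image_gen[OF assms(1), of "\<lambda>_. 1::nat" g] by simp
  also have "\<dots> = k * card (g ` W)" using assms(2) by simp
  finally show ?thesis .
qed

text \<open>The last hypothesis is a Chinese remainder condition. Translation by an element that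
  lies in every earlier subgroup and in a prescribed coset of \<open>S\<close> permutes the
  survivors, so these are spread evenly over the cosets of \<open>S\<close>; avoiding
  \<open>S\<close> as well removes one of \<open>card (reps S)\<close> equal shares.\<close>

lemma card_reps_avoiding:
  assumes "subgrp K" "finite (reps K)" "finite T"
    and "\<And>S. S \<in> T \<Longrightarrow> subgrp S \<and> K \<subseteq> S"
    and "\<And>S c. S \<in> T \<Longrightarrow> \<exists>e. e - c \<in> S \<and> (\<forall>S'\<in>T - {S}. e \<in> S')"
  shows "real (card {x \<in> reps K. \<forall>S\<in>T. x \<notin> S}) =
    real (card (reps K)) * (\<Prod>S\<in>T. 1 - inverse (real (card (reps S))))"
  using assms(3,4,5)
proof (induction T rule: finite_induct)
  case empty
  then show ?case by simp
next
  case (insert S T)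
  let ?X = "{x \<in> reps K. \<forall>S\<in>T. x \<notin> S}"
  have S: "subgrp S" "K \<subseteq> S" and T: "\<And>S'. S' \<in> T \<Longrightarrow> subgrp S' \<and> K \<subseteq> S'"
    using insert.prems(1) by auto
  have move: "\<exists>e. e - c \<in> S \<and> (\<forall>S'\<in>T. e \<in> S')" for c
    using insert.prems(2)[of S c] insert.hyps(2) by (auto simp: Diff_insert_absorb)
  have IH: "real (card ?X) = real (card (reps K)) * (\<Prod>S\<in>T. 1 - inverse (real (card (reps S))))"
  proof (rule insert.IH)
    fix S' c assume "S' \<in> T"
    then show "\<exists>e. e - c \<in> S' \<and> (\<forall>S''\<in>T - {S'}. e \<in> S'')"
      using insert.prems(2)[of S' c] by blast
  qed (use T in blast)
  have finX: "finite ?X" using assms(2) by simp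
  have finS: "finite (reps S)" using finite_reps_mono[OF assms(1) S assms(2)] .
  define k where "k = card {x \<in> ?X. x \<in> S}"
  have shift: "rep K (x + e) \<in> ?X" if "x \<in> ?X" "\<forall>S'\<in>T. e \<in> S'" for x e
  proof -
    have "rep K (x + e) \<notin> S'" if "S' \<in> T" for S'
      using that T[of S'] rep_cong(1)[of S' K "x + e"] assms(1)
        subgrp_cong[of S' "x + e" x] \<open>x \<in> ?X\<close> \<open>\<forall>S'\<in>T. e \<in> S'\<close> by auto
    then show ?thesis by (simp add: rep_mem)
  qed
  have fib: "card {x \<in> ?X. x - c \<in> S} = k" for c
  proof -
    obtain e where e: "e - c \<in> S" "\<forall>S'\<in>T. e \<in> S'" using move by blast
    have e': "\<forall>S'\<in>T. - e \<in> S'" using e(2) T subgrp_minus by blast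
    \<comment> \<open>Translation by \<open>- e\<close> carries the coset of \<open>c\<close> to
      \<open>S\<close>. As \<open>e\<close> lies in all members of \<open>T\<close>, membership in
      these does not change, and \<open>rep K\<close> leads back to representatives.\<close>
    have "bij_betw (\<lambda>x. rep K (x + - e)) {x \<in> ?X. x - c \<in> S} {x \<in> ?X. x \<in> S}"
    proof (rule bij_betwI[where g = "\<lambda>x. rep K (x + e)"])
      show "(\<lambda>x. rep K (x + - e)) \<in> {x \<in> ?X. x - c \<in> S} \<rightarrow> {x \<in> ?X. x \<in> S}"
        using shift[OF _ e'] rep_cong(1)[OF S assms(1)] subgrp_diff[OF S(1) _ e(1)]
        by (fastforce simp: algebra_simps)
      show "(\<lambda>x. rep K (x + e)) \<in> {x \<in> ?X. x \<in> S} \<rightarrow> {x \<in> ?X. x - c \<in> S}"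
        using shift[OF _ e(2)] rep_cong(2)[OF S assms(1)] subgrp_add[OF S(1) _ e(1)]
        by (fastforce simp: algebra_simps)
      show "rep K (rep K (x + - e) + e) = x" if "x \<in> {x \<in> ?X. x - c \<in> S}" for x
        using that rep_idem[OF assms(1), of x] rep_eq_iff[OF assms(1), of "rep K (x + - e) + e" x]
          rep_diff[OF assms(1), of "x + - e"] by (auto simp: algebra_simps)
      show "rep K (rep K (x + e) + - e) = x" if "x \<in> {x \<in> ?X. x \<in> S}" for x
        using that rep_idem[OF assms(1), of x] rep_eq_iff[OF assms(1), of "rep K (x + e) + - e" x]
          rep_diff[OF assms(1), of "x + e"] by (auto simp: algebra_simps)
    qed
    then show ?thesis unfolding k_def by (rule bij_betw_same_card)
  qed
  have cardX: "card ?X = card (reps S) * k"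
  proof (cases "?X = {}")
    case True
    then have "{x \<in> ?X. x \<in> S} = {}" by blast
    then show ?thesis using True by (simp only: k_def card.empty)
  next
    case False
    have "card ?X = k * card (rep S ` ?X)"
    proof (rule card_eq_fibres[OF finX])
      fix y assume "y \<in> rep S ` ?X"
      then obtain z where z: "y = rep S z" by blast
      have "{x \<in> ?X. rep S x = y} = {x \<in> ?X. x - z \<in> S}"
        using rep_eq_iff[OF S(1)] z by auto
      then show "card {x \<in> ?X. rep S x = y} = k" using fib by simp
    qed
    \<comment> \<open>A survivor \<open>x0\<close> moves into the coset of any \<open>c\<close> by
      adding an element congruent to \<open>c - x0\<close> modulo \<open>S\<close>, so no coset is
      missed.\<close>
    moreover have "rep S ` ?X = reps S"
    proof -
      obtain x0 where x0: "x0 \<in> ?X" using False by blast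
      have "rep S c \<in> rep S ` ?X" for c
      proof -
        obtain e where e: "e - (c - x0) \<in> S" "\<forall>S'\<in>T. e \<in> S'" using move by blast
        have "rep K (x0 + e) - c \<in> S"
          using e(1) rep_cong(2)[OF S assms(1), of "x0 + e" c] by (simp add: algebra_simps)
        then have "rep S (rep K (x0 + e)) = rep S c" using rep_eq_iff[OF S(1)] by blast
        moreover have "rep S (rep K (x0 + e)) \<in> rep S ` ?X"
          using shift[OF x0 e(2)] by (rule imageI)
        ultimately show ?thesis by simp
      qed
      then show ?thesis by (auto simp: reps_def)
    qed
    ultimately show ?thesis by simp
  qed
  define s where "s = card (reps S)"
  \<comment> \<open>Positivity keeps the natural subtraction \<open>s * k - k\<close> from being
    truncated and makes \<open>inverse\<close> a true inverse of \<open>s\<close>.\<close>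
  have s: "s \<ge> 1"
    unfolding s_def using finS by (simp add: Suc_le_eq card_gt_0_iff reps_def)
  have "{x \<in> reps K. \<forall>S\<in>insert S T. x \<notin> S} = ?X - {x \<in> ?X. x \<in> S}" by auto
  also have "card \<dots> = card ?X - k"
    unfolding k_def by (rule card_Diff_subset) (auto intro: rev_finite_subset[OF finX])
  also have "real \<dots> = real (card ?X) * (1 - inverse (real s))"
  proof -
    obtain s' where "s = Suc s'" using s by (cases s) auto
    then show ?thesis unfolding cardX s_def[symmetric] by (simp add: field_simps)
  qed
  finally have "real (card {x \<in> reps K. \<forall>S\<in>insert S T. x \<notin> S}) =
      real (card ?X) * (1 - inverse (real (card (reps S))))"
    unfolding s_def .
  then show ?case
    unfolding IH prod.insert[OF insert.hyps] by (simp only: mult_ac)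
qed

section \<open>Ideals and primes of finite index\<close>

lemma ring_of_type_algebra_simps [simp]:
  "carrier (ring_of_type_algebra :: 'a::idom ring) = UNIV"
  "x \<otimes>\<^bsub>ring_of_type_algebra\<^esub> y = x * (y :: 'a)"
  "x \<oplus>\<^bsub>ring_of_type_algebra\<^esub> y = x + (y :: 'a)"
  "\<zero>\<^bsub>ring_of_type_algebra\<^esub> = (0 :: 'a)"
  "\<one>\<^bsub>ring_of_type_algebra\<^esub> = (1 :: 'a)"
  by (simp_all add: ring_of_type_algebra_def)

lemma a_inv_ring_of_type_algebra [simp]:
  "\<ominus>\<^bsub>ring_of_type_algebra\<^esub> x = - (x :: 'a::idom)"
proof -
  interpret ring "ring_of_type_algebra :: 'a ring" by (rule ring_from_type_algebra)
  show ?thesis by (rule minus_equality) auto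
qed

lemma ideal_iff:
  "ideal I (ring_of_type_algebra :: 'a::idom ring) \<longleftrightarrow> subgrp I \<and> (\<forall>x\<in>I. \<forall>r. r * x \<in> I)"
proof
  assume "ideal I (ring_of_type_algebra :: 'a ring)"
  then interpret ideal I "ring_of_type_algebra :: 'a ring" .
  have "x - y \<in> I" if "x \<in> I" "y \<in> I" for x y
    using additive_subgroup.a_closed[OF additive_subgroup_axioms, of x "- y"] I_l_closed[of y "- 1"] that
    by simp
  then show "subgrp I \<and> (\<forall>x\<in>I. \<forall>r. r * x \<in> I)"
    using additive_subgroup.zero_closed[OF additive_subgroup_axioms] I_l_closed
    by (auto simp: subgrp_def)
next
  assume *: "subgrp I \<and> (\<forall>x\<in>I. \<forall>r. r * x \<in> I)"
  show "ideal I (ring_of_type_algebra :: 'a ring)"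
  proof (rule idealI[OF ring_from_type_algebra])
    show "subgroup I (add_monoid (ring_of_type_algebra :: 'a ring))"
    proof
      show "inv\<^bsub>add_monoid ring_of_type_algebra\<^esub> x \<in> I" if "x \<in> I" for x
        using a_inv_ring_of_type_algebra[of x] that * subgrp_minus
        by (auto simp: a_inv_def)
    qed (use * in \<open>auto simp: subgrp_add subgrp_zero\<close>)
  qed (use * in \<open>auto simp: mult.commute\<close>)
qed

lemma ideal_subgrp: "ideal I (ring_of_type_algebra :: 'a::idom ring) \<Longrightarrow> subgrp I"
  and ideal_mult: "ideal I (ring_of_type_algebra :: 'a::idom ring) \<Longrightarrow> x \<in> I \<Longrightarrow> r * x \<in> I"
  and ideal_mult_right: "ideal I (ring_of_type_algebra :: 'a::idom ring) \<Longrightarrow> x \<in> I \<Longrightarrow> x * r \<in> I"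
  by (auto simp: ideal_iff mult.commute)

lemma ideal_one: "ideal I (ring_of_type_algebra :: 'a::idom ring) \<Longrightarrow> 1 \<in> I \<longleftrightarrow> I = UNIV"
  using ideal_mult[of I 1] by auto

lemma primeideal_iff:
  "primeideal P (ring_of_type_algebra :: 'a::idom ring) \<longleftrightarrow>
    ideal P ring_of_type_algebra \<and> 1 \<notin> P \<and> (\<forall>x y. x * y \<in> P \<longrightarrow> x \<in> P \<or> y \<in> P)"
proof
  assume "primeideal P (ring_of_type_algebra :: 'a ring)"
  then interpret primeideal P "ring_of_type_algebra :: 'a ring" .
  show "ideal P ring_of_type_algebra \<and> 1 \<notin> P \<and> (\<forall>x y. x * y \<in> P \<longrightarrow> x \<in> P \<or> y \<in> P)"
    using is_ideal I_notcarr I_prime ideal_one[OF is_ideal] by auto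
next
  assume *: "ideal P ring_of_type_algebra \<and> 1 \<notin> P \<and> (\<forall>x y. x * y \<in> P \<longrightarrow> x \<in> P \<or> y \<in> P)"
  then show "primeideal P (ring_of_type_algebra :: 'a ring)"
    by (intro primeidealI cring_from_type_algebra) auto
qed

lemma primeideal_ideal: "primeideal P (ring_of_type_algebra :: 'a::idom ring) \<Longrightarrow> ideal P ring_of_type_algebra"
  and primeideal_one: "primeideal P (ring_of_type_algebra :: 'a::idom ring) \<Longrightarrow> 1 \<notin> P"
  and primeideal_mult: "primeideal P (ring_of_type_algebra :: 'a::idom ring) \<Longrightarrow> x * y \<in> P \<Longrightarrow> x \<in> P \<or> y \<in> P"
  by (auto simp: primeideal_iff)

lemma primeideal_power:
  "primeideal P (ring_of_type_algebra :: 'a::idom ring) \<Longrightarrow> x ^ n \<in> P \<Longrightarrow> x \<in> P"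
  by (induction n) (auto simp: primeideal_iff)

lemma PIdl_eq: "PIdl\<^bsub>ring_of_type_algebra\<^esub> a = {x :: 'a::idom. a dvd x}"
  by (auto simp: cgenideal_def dvd_def mult.commute)

lemma ideal_dvd: "ideal {x :: 'a::idom. a dvd x} ring_of_type_algebra"
  by (auto simp: ideal_iff subgrp_def)

lemma bij_betw_reps_Quot:
  assumes "ideal I (ring_of_type_algebra :: 'a::idom ring)"
  shows "bij_betw (\<lambda>x. I +>\<^bsub>ring_of_type_algebra\<^esub> x) (reps I) (carrier (ring_of_type_algebra Quot I))"
proof -
  have S: "subgrp I" using assms by (rule ideal_subgrp)
  have coset: "I +>\<^bsub>ring_of_type_algebra\<^esub> x = {y. y - x \<in> I}" for x
  proof -
    have "\<exists>i\<in>I. y = i + x" if "y - x \<in> I" for y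
      using that by (intro bexI[of _ "y - x"]) auto
    then show ?thesis by (auto simp: a_r_coset_def r_coset_def)
  qed
  have eq: "I +>\<^bsub>ring_of_type_algebra\<^esub> x = I +>\<^bsub>ring_of_type_algebra\<^esub> y \<longleftrightarrow> x - y \<in> I" for x y
  proof
    assume "I +>\<^bsub>ring_of_type_algebra\<^esub> x = I +>\<^bsub>ring_of_type_algebra\<^esub> y"
    then have "x \<in> {z. z - y \<in> I}" unfolding coset using subgrp_zero[OF S] by auto
    then show "x - y \<in> I" by simp
  next
    assume "x - y \<in> I"
    then have "z - x \<in> I \<longleftrightarrow> z - y \<in> I" for z
      using subgrp_cong[OF S, of "z - y" "z - x"] by auto
    then show "I +>\<^bsub>ring_of_type_algebra\<^esub> x = I +>\<^bsub>ring_of_type_algebra\<^esub> y"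
      unfolding coset by blast
  qed
  have "I +>\<^bsub>ring_of_type_algebra\<^esub> x \<in> (\<lambda>x. I +>\<^bsub>ring_of_type_algebra\<^esub> x) ` reps I" for x
    using eq[of x "rep I x"] rep_diff[OF S, of x] subgrp_swap[OF S] rep_mem by blast
  then show ?thesis
    unfolding bij_betw_def FactRing_def A_RCOSETS_def'
    by (auto simp: inj_on_def eq reps_inj[OF S])
qed

lemma ideal_norm_eq:
  assumes "ideal I (ring_of_type_algebra :: 'a::idom ring)"
  shows "ideal_norm I = card (reps I)"
  unfolding ideal_norm_def using bij_betw_same_card[OF bij_betw_reps_Quot[OF assms]] by simp

lemma norm_finiteD:
  assumes "norm_finite TYPE('a::idom)" "ideal I (ring_of_type_algebra :: 'a ring)" "a \<in> I" "a \<noteq> 0"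
  shows "finite (reps I)"
proof (rule finite_reps_mono)
  show "finite (reps {x. a dvd x})"
    using assms(1,4) bij_betw_finite[OF bij_betw_reps_Quot[OF ideal_dvd[of a]]]
    by (auto simp: norm_finite_def PIdl_eq)
  show "{x. a dvd x} \<subseteq> I" using assms(2,3) by (auto simp: dvd_def ideal_mult_right)
qed (use assms(2) ideal_dvd ideal_subgrp in blast)+

lemma ideal_add_multiples:
  assumes "ideal I (ring_of_type_algebra :: 'a::idom ring)"
  shows "ideal {i + r * a | i r. i \<in> I} (ring_of_type_algebra :: 'a ring)"
  unfolding ideal_iff subgrp_def
proof (intro conjI ballI allI)
  show "0 \<in> {i + r * a | i r. i \<in> I}"
    using subgrp_zero[OF ideal_subgrp[OF assms]] by (auto intro!: exI[of _ 0])
  fix x assume "x \<in> {i + r * a | i r. i \<in> I}"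
  then obtain i r where x: "i \<in> I" "x = i + r * a" by blast
  show "c * x \<in> {i + r * a | i r. i \<in> I}" for c
    using x ideal_mult[OF assms x(1), of c]
    by (intro CollectI exI[of _ "c * i"] exI[of _ "c * r"]) (simp add: algebra_simps)
  fix y assume "y \<in> {i + r * a | i r. i \<in> I}"
  then obtain j s where y: "j \<in> I" "y = j + s * a" by blast
  show "x - y \<in> {i + r * a | i r. i \<in> I}"
    using x y subgrp_diff[OF ideal_subgrp[OF assms] x(1) y(1)]
    by (intro CollectI exI[of _ "i - j"] exI[of _ "r - s"]) (simp add: algebra_simps)
qed

text \<open>Finite index leaves only finitely many ideals above \<open>J\<close>, so a maximal
  proper one \<open>M\<close> exists. Adjoining any \<open>x\<close> outside \<open>M\<close> yields
  \<open>1\<close>, and this makes \<open>M\<close> prime.\<close>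

lemma exists_prime_above:
  assumes "ideal J (ring_of_type_algebra :: 'a::idom ring)" "finite (reps J)" "1 \<notin> J"
  shows "\<exists>P. primeideal P ring_of_type_algebra \<and> J \<subseteq> P"
proof -
  let ?F = "{M :: 'a set. ideal M ring_of_type_algebra \<and> J \<subseteq> M \<and> 1 \<notin> M}"
  have "?F \<subseteq> {S. subgrp S \<and> J \<subseteq> S}" using ideal_subgrp by blast
  then have "finite ?F"
    using finite_supergroups[OF ideal_subgrp[OF assms(1)] assms(2)] finite_subset by blast
  then obtain M where M: "M \<in> ?F" and max: "\<forall>M'\<in>?F. M \<subseteq> M' \<longrightarrow> M = M'"
    using finite_has_maximal2[of ?F J] assms by auto
  have "y \<in> M" if xy: "x * y \<in> M" and x: "x \<notin> M" for x y
  proof -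
    define N where "N = {i + r * x | i r. i \<in> M}"
    have z: "0 \<in> M" using M ideal_subgrp subgrp_zero by blast
    have sub: "M \<subseteq> N" unfolding N_def by (force intro: exI[of _ 0])
    have xN: "x \<in> N" unfolding N_def using z by (force intro: exI[of _ 0] exI[of _ 1])
    have "ideal N ring_of_type_algebra" unfolding N_def using M ideal_add_multiples by blast
    moreover have "M \<noteq> N" using xN x by blast
    ultimately have "1 \<in> N" using M max sub by blast
    then obtain i r where i: "i \<in> M" "1 = i + r * x" unfolding N_def by blast
    then have "y = (i + r * x) * y" by simp
    also have "\<dots> = y * i + r * (x * y)" by (simp add: algebra_simps)
    also have "\<dots> \<in> M"
      by (rule subgrp_add[OF ideal_subgrp ideal_mult ideal_mult]) (use M i(1) xy in auto)
    finally show "y \<in> M" .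
  qed
  then show ?thesis using M primeideal_iff by blast
qed

text \<open>Two powers of \<open>a\<close> agree modulo \<open>P\<close>; primality cancels the
  smaller one and leaves a power of \<open>a\<close> as the inverse.\<close>

lemma prime_maximal:
  assumes "primeideal P (ring_of_type_algebra :: 'a::idom ring)" "finite (reps P)" "a \<notin> P"
  shows "\<exists>r. r * a - 1 \<in> P"
proof -
  obtain m n :: nat where mn: "m < n" "a ^ n - a ^ m \<in> P"
    by (rule reps_pigeonhole[OF ideal_subgrp[OF primeideal_ideal[OF assms(1)]] assms(2)])
  obtain k where k: "n = m + Suc k" using mn(1) less_iff_Suc_add by auto
  have "a ^ n - a ^ m = a ^ m * (a ^ k * a - 1)"
    by (simp add: k power_add algebra_simps)
  then have "a ^ m \<in> P \<or> a ^ k * a - 1 \<in> P"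
    using mn(2) primeideal_mult[OF assms(1)] by simp
  then show ?thesis using assms(3) primeideal_power[OF assms(1)] by blast
qed

lemma prime_not_subset:
  assumes "primeideal P (ring_of_type_algebra :: 'a::idom ring)"
    "primeideal Q (ring_of_type_algebra :: 'a ring)" "finite (reps Q)" "Q \<subseteq> P"
  shows "P = Q"
proof (rule ccontr)
  assume "P \<noteq> Q"
  then obtain b where b: "b \<in> P" "b \<notin> Q" using assms(4) by blast
  obtain r where "r * b - 1 \<in> P" using prime_maximal[OF assms(2,3) b(2)] assms(4) by blast
  then have "1 \<in> P"
    using b(1) ideal_mult subgrp_cong[OF ideal_subgrp, of P "r * b" 1] primeideal_ideal[OF assms(1)]
    by blast
  then show False using primeideal_one[OF assms(1)] by blast
qed

text \<open>The element is a product with one factor for each \<open>Q\<close>: a member of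
  \<open>Q\<close> outside \<open>P\<close>, scaled to be \<open>1\<close> modulo
  \<open>P\<close>.\<close>

lemma prime_separating:
  assumes "finite T" "primeideal P (ring_of_type_algebra :: 'a::idom ring)" "finite (reps P)"
    "\<And>Q. Q \<in> T \<Longrightarrow> primeideal Q (ring_of_type_algebra :: 'a ring) \<and> finite (reps Q) \<and> Q \<noteq> P"
  shows "\<exists>e. e - 1 \<in> P \<and> (\<forall>Q\<in>T. e \<in> Q)"
  using assms(1,4)
proof (induction T rule: finite_induct)
  case empty
  then show ?case
    using subgrp_zero[OF ideal_subgrp[OF primeideal_ideal[OF assms(2)]]] by (auto intro: exI[of _ 1])
next
  case (insert Q T)
  obtain e where e: "e - 1 \<in> P" "\<forall>Q\<in>T. e \<in> Q" using insert by blast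
  obtain a where a: "a \<in> Q" "a \<notin> P"
    using prime_not_subset[OF assms(2), of Q] insert.prems[of Q] by auto
  obtain r where r: "r * a - 1 \<in> P" using prime_maximal[OF assms(2,3) a(2)] by blast
  have P: "ideal P ring_of_type_algebra" using primeideal_ideal[OF assms(2)] .
  have "e * (r * a) - 1 = e * (r * a - 1) + (e - 1)" by (simp add: algebra_simps)
  also have "\<dots> \<in> P" by (intro subgrp_add ideal_subgrp ideal_mult P r e)
  finally have "e * (r * a) - 1 \<in> P" .
  moreover have "\<forall>Q'\<in>insert Q T. e * (r * a) \<in> Q'"
  proof
    fix Q' assume Q': "Q' \<in> insert Q T"
    then have Q'I: "ideal Q' ring_of_type_algebra" using insert.prems primeideal_ideal by blast
    show "e * (r * a) \<in> Q'"
      using Q' e(2) ideal_mult[OF Q'I, of a "e * r"] ideal_mult_right[OF Q'I, of e "r * a"] a(1)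
      by (auto simp: mult.assoc)
  qed
  ultimately show ?case by blast
qed

text \<open>Modulo the primes of \<open>T\<close> the elements \<open>e P\<close> behave like
  orthogonal idempotents, so sums of multiples of them prescribe residues at all these primes at
  once.\<close>

lemma prime_chinese_remainder:
  assumes "finite T"
    "\<And>Q. Q \<in> T \<Longrightarrow> primeideal Q (ring_of_type_algebra :: 'a::idom ring) \<and> finite (reps Q)"
  obtains e where "\<And>P. P \<in> T \<Longrightarrow> e P - 1 \<in> P" "\<And>P Q. P \<in> T \<Longrightarrow> Q \<in> T \<Longrightarrow> P \<noteq> Q \<Longrightarrow> e P \<in> Q"
proof -
  have "\<exists>e. e - 1 \<in> P \<and> (\<forall>Q\<in>T - {P}. e \<in> Q)" if "P \<in> T" for P
    using that assms by (intro prime_separating) auto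
  then have "\<forall>P\<in>T. \<exists>e. e - 1 \<in> P \<and> (\<forall>Q\<in>T - {P}. e \<in> Q)" by blast
  then obtain e where "\<forall>P\<in>T. e P - 1 \<in> P \<and> (\<forall>Q\<in>T - {P}. e P \<in> Q)" by (auto dest: bchoice)
  then show thesis using that[of e] by auto
qed

section \<open>Primes dividing a fixed nonzero ideal of finite index\<close>

context
  fixes I :: "'a::idom set" and d :: 'a
  assumes I: "ideal I ring_of_type_algebra" and fin: "finite (reps I)" and d: "d \<in> I" "d \<noteq> 0"
begin

lemma prime_dividingD:
  assumes "P \<in> prime_ideals_dividing I"
  shows "primeideal P ring_of_type_algebra" "I \<subseteq> P" "finite (reps P)"
  using assms finite_reps_mono[OF ideal_subgrp[OF I] _ _ fin] primeideal_ideal ideal_subgrp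
  by (auto simp: prime_ideals_dividing_def)

lemma finite_prime_ideals_dividing: "finite (prime_ideals_dividing I)"
proof (rule finite_subset)
  show "prime_ideals_dividing I \<subseteq> {S. subgrp S \<and> I \<subseteq> S}"
    using primeideal_ideal ideal_subgrp by (auto simp: prime_ideals_dividing_def)
qed (rule finite_supergroups[OF ideal_subgrp[OF I] fin])

lemma exists_prime_dividing:
  assumes "ideal J ring_of_type_algebra" "I \<subseteq> J" "1 \<notin> J"
  shows "\<exists>P\<in>prime_ideals_dividing I. J \<subseteq> P"
proof -
  obtain P where P: "primeideal P ring_of_type_algebra" "J \<subseteq> P"
    using exists_prime_above[OF assms(1) _ assms(3)]
      finite_reps_mono[OF ideal_subgrp[OF I] ideal_subgrp[OF assms(1)] assms(2) fin] by blast
  \<comment> \<open>The nonzero element \<open>d\<close> of \<open>I\<close> lies in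
    \<open>P\<close>, so \<open>P\<close> is not the zero ideal.\<close>
  then have "P \<in> prime_ideals_dividing I"
    using d assms(2) by (auto simp: prime_ideals_dividing_def)
  then show ?thesis using P(2) by blast
qed

text \<open>The ideal generated by \<open>I\<close>, \<open>a\<close> and \<open>b\<close> contains
  \<open>I\<close> but lies in no prime dividing \<open>I\<close>, hence it contains
  \<open>1\<close>.\<close>

lemma coprime_mod_ideal:
  assumes "\<And>P. P \<in> prime_ideals_dividing I \<Longrightarrow> a \<notin> P \<or> b \<notin> P"
  obtains i r s where "i \<in> I" "i + r * a + s * b = 1"
proof -
  define J where "J = {i + r * a | i r. i \<in> I}"
  define K where "K = {j + s * b | j s. j \<in> J}"
  have J: "ideal J ring_of_type_algebra" unfolding J_def using ideal_add_multiples[OF I] .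
  have K: "ideal K ring_of_type_algebra" unfolding K_def using ideal_add_multiples[OF J] .
  have IJ: "I \<subseteq> J" unfolding J_def by (force intro: exI[of _ 0])
  have JK: "J \<subseteq> K" unfolding K_def by (force intro: exI[of _ 0])
  have "a \<in> J"
    unfolding J_def using subgrp_zero[OF ideal_subgrp[OF I]] by (force intro: exI[of _ 0] exI[of _ 1])
  moreover have "b \<in> K"
    unfolding K_def using subgrp_zero[OF ideal_subgrp[OF J]] by (force intro: exI[of _ 0] exI[of _ 1])
  ultimately have "1 \<in> K"
    using exists_prime_dividing[OF K] IJ JK assms by (metis subsetD subset_trans)
  then obtain j s where "j \<in> J" "1 = j + s * b" unfolding K_def by blast
  moreover from this obtain i r where "i \<in> I" "j = i + r * a" unfolding J_def by blast
  ultimately show thesis using that[of i r s] by simp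
qed

text \<open>By Chinese remaindering, \<open>t\<close> is made \<open>1\<close> modulo the primes
  that contain \<open>a\<close> and \<open>0\<close> modulo the others. Then
  \<open>a + t * b\<close> is congruent to \<open>b\<close> in the first case and to
  \<open>a\<close> in the second, each time to an element outside the prime.\<close>

lemma stable_range:
  assumes "\<And>P. P \<in> prime_ideals_dividing I \<Longrightarrow> a \<notin> P \<or> b \<notin> P"
  shows "\<exists>t. \<forall>P\<in>prime_ideals_dividing I. a + t * b \<notin> P"
proof -
  let ?T = "prime_ideals_dividing I"
  obtain e where e: "\<And>P. P \<in> ?T \<Longrightarrow> e P - 1 \<in> P"
      "\<And>P Q. P \<in> ?T \<Longrightarrow> Q \<in> ?T \<Longrightarrow> P \<noteq> Q \<Longrightarrow> e P \<in> Q"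
    by (rule prime_chinese_remainder[OF finite_prime_ideals_dividing]) (use prime_dividingD in blast)+
  define t where "t = (\<Sum>P | P \<in> ?T \<and> a \<in> P. e P)"
  have "a + t * b \<notin> P" if P: "P \<in> ?T" for P
  proof -
    have PI: "primeideal P ring_of_type_algebra" using prime_dividingD[OF P] by blast
    have S: "subgrp P" using PI primeideal_ideal ideal_subgrp by blast
    show ?thesis
    proof (cases "a \<in> P")
      case True
      have "t = e P + (\<Sum>Q\<in>{P. P \<in> ?T \<and> a \<in> P} - {P}. e Q)"
        unfolding t_def by (rule sum.remove) (use True P finite_prime_ideals_dividing in auto)
      moreover have "(\<Sum>Q\<in>{P. P \<in> ?T \<and> a \<in> P} - {P}. e Q) \<in> P"
        by (rule subgrp_sum[OF S]) (use e(2) P in auto)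
      ultimately have "t - 1 \<in> P"
        using subgrp_add[OF S e(1)[OF P]] by (metis add_diff_eq add.commute)
      then have "t \<notin> P" using subgrp_cong[OF S] primeideal_one[OF PI] by blast
      then have "t * b \<notin> P" using assms[OF P] True primeideal_mult[OF PI] by blast
      then show ?thesis using subgrp_cong[OF S, of "a + t * b" "t * b"] True by simp
    next
      case False
      have "t \<in> P" unfolding t_def by (rule subgrp_sum[OF S]) (use e(2) P False in auto)
      then have "t * b \<in> P" using ideal_mult_right[OF primeideal_ideal[OF PI]] by blast
      then show ?thesis using subgrp_cong[OF S, of "a + t * b" a] False by simp
    qed
  qed
  then show ?thesis by blast
qed

end

text \<open>Two moves within the classes modulo \<open>I\<close>: make the first entry nonzero, so
  that only finitely many primes contain it, then shift the second entry to avoid all of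
  these.\<close>

lemma lift_unimodular:
  assumes "norm_finite TYPE('a::idom)" "ideal I (ring_of_type_algebra :: 'a ring)"
    "d \<in> I" "d \<noteq> 0"
    and "\<And>P. P \<in> prime_ideals_dividing I \<Longrightarrow> a \<notin> P \<or> b \<notin> P"
  obtains x y p q where "x - a \<in> I" "y - b \<in> I" "x * p + y * q = 1"
proof -
  note fin = norm_finiteD[OF assms(1)]
  have S: "subgrp I" using assms(2) by (rule ideal_subgrp)
  \<comment> \<open>Replacing \<open>0\<close> by the nonzero element \<open>d\<close> of
    \<open>I\<close> keeps the class and makes the quotient by \<open>x\<close> finite.\<close>
  define x where "x = (if a = 0 then d else a)"
  have x0: "x \<noteq> 0" and xa: "x - a \<in> I"
    using assms(3,4) subgrp_zero[OF S] by (auto simp: x_def)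
  have "x \<notin> P \<or> b \<notin> P" if P: "P \<in> prime_ideals_dividing I" for P
  proof -
    have "x - a \<in> P" using P xa by (auto simp: prime_ideals_dividing_def)
    moreover have "subgrp P"
      using P primeideal_ideal ideal_subgrp by (auto simp: prime_ideals_dividing_def)
    ultimately show ?thesis using assms(5)[OF P] subgrp_cong[of P x a] by blast
  qed
  then obtain s r k where s: "s \<in> I" "s + r * x + k * b = 1"
    using coprime_mod_ideal[OF assms(2) fin[OF assms(2-4)] assms(3,4)] by blast
  note X = ideal_dvd[of x]
  have x: "x \<in> {z. x dvd z}" by simp
  note finX = fin[OF X x x0]
  \<comment> \<open>A prime containing \<open>x\<close>, \<open>b\<close> and \<open>s\<close> would
    contain \<open>1\<close>. So \<open>stable_range\<close> modulo \<open>x\<close> can correct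
    \<open>b\<close> by a multiple of \<open>s\<close>, which stays in \<open>I\<close>.\<close>
  have "b \<notin> P \<or> s \<notin> P" if P: "P \<in> prime_ideals_dividing {z. x dvd z}" for P
  proof -
    have PI: "primeideal P ring_of_type_algebra" and "x \<in> P"
      using prime_dividingD[OF X finX x x0 P] x by blast+
    note P' = primeideal_ideal[OF PI]
    have "1 \<in> P" if "b \<in> P" "s \<in> P"
      unfolding s(2)[symmetric]
      by (intro subgrp_add ideal_subgrp ideal_mult P' that \<open>x \<in> P\<close>)
    then show ?thesis using primeideal_one[OF PI] by blast
  qed
  then obtain t where t: "\<forall>P\<in>prime_ideals_dividing {z. x dvd z}. b + t * s \<notin> P"
    using stable_range[OF X finX x x0] by blast
  \<comment> \<open>Both entries are taken equal, so the outcome is that \<open>b + t * s\<close> is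
    a unit modulo \<open>x\<close>, with inverse \<open>p + q\<close>.\<close>
  obtain i p q where ipq: "i \<in> {z. x dvd z}" "i + p * (b + t * s) + q * (b + t * s) = 1"
    by (rule coprime_mod_ideal[OF X finX x x0, of "b + t * s" "b + t * s"]) (use t in blast)
  from ipq(1) obtain c where "i = x * c" by (auto elim: dvdE)
  then have "x * c + (b + t * s) * (p + q) = 1" using ipq(2) by (simp add: algebra_simps)
  moreover have "(b + t * s) - b \<in> I" using ideal_mult[OF assms(2) s(1)] by simp
  ultimately show thesis using that[OF xa, of "b + t * s"] by blast
qed

section \<open>Invertibility of ideals\<close>

text \<open>Among the annihilators modulo \<open>a\<close> that are contained in \<open>P\<close>, a
  maximal one \<open>ann b\<close> is shown to be \<open>P\<close> itself. If nothing outside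
  \<open>P\<close> killed \<open>p * b\<close>, multiplying \<open>b\<close> by powers of
  \<open>p\<close> would leave its annihilator unchanged; but two such powers agree modulo
  \<open>a\<close>, which forces \<open>1\<close> into \<open>P\<close>.\<close>

lemma prime_annihilator:
  assumes P: "primeideal P (ring_of_type_algebra :: 'a::idom ring)"
    and a: "a \<in> P" and fin: "finite (reps {x. a dvd x})"
  obtains b where "\<not> a dvd b" "\<And>p. p \<in> P \<Longrightarrow> a dvd p * b"
proof -
  define ann where "ann b = {x. a dvd x * b}" for b
  let ?F = "{A \<in> range ann. A \<subseteq> P}"
  note PI = primeideal_ideal[OF P]
  have "?F \<subseteq> {S. subgrp S \<and> {x. a dvd x} \<subseteq> S}"
    by (auto simp: ann_def subgrp_def algebra_simps)
  then have "finite ?F"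
    using finite_supergroups[OF ideal_subgrp[OF ideal_dvd] fin] finite_subset by blast
  moreover have "ann 1 \<in> ?F"
  proof -
    have "ann 1 \<subseteq> P" using ideal_mult_right[OF PI a] by (auto simp: ann_def elim!: dvdE)
    then show ?thesis by blast
  qed
  ultimately obtain A where A: "A \<in> ?F" "\<And>A'. A' \<in> ?F \<Longrightarrow> A \<subseteq> A' \<Longrightarrow> A = A'"
    using finite_has_maximal2[of ?F "ann 1"] by auto
  then obtain b where b: "A = ann b" by blast
  have max: "ann (c * b) = ann b" if "ann (c * b) \<subseteq> P" for c
  proof -
    have "a dvd x * (c * b)" if "a dvd x * b" for x
      using dvd_mult[OF that, of c] by (simp add: mult.left_commute)
    then have "ann b \<subseteq> ann (c * b)" by (auto simp: ann_def)
    then show ?thesis using A(2)[of "ann (c * b)"] that b by auto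
  qed
  have bP: "ann b \<subseteq> P" using A(1) b by blast
  have "p \<in> ann b" if p: "p \<in> P" for p
  proof -
    have "\<exists>s. s \<notin> P \<and> s \<in> ann (p * b)"
    proof (rule ccontr)
      assume "\<not> (\<exists>s. s \<notin> P \<and> s \<in> ann (p * b))"
      then have eq: "ann (p * b) = ann b" by (intro max) blast
      have pow: "x \<in> ann (p ^ n * b) \<longleftrightarrow> x \<in> ann b" for n x
      proof (induction n arbitrary: x)
        case (Suc n)
        have "x \<in> ann (p ^ Suc n * b) \<longleftrightarrow> x * p \<in> ann (p ^ n * b)"
          by (simp add: ann_def mult.assoc)
        also have "\<dots> \<longleftrightarrow> x * p \<in> ann b" by (rule Suc)
        also have "\<dots> \<longleftrightarrow> x \<in> ann (p * b)" by (simp add: ann_def mult.assoc)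
        finally show ?case using eq by simp
      qed simp
      obtain m n :: nat where mn: "m < n" "p ^ n - p ^ m \<in> {x. a dvd x}"
        by (rule reps_pigeonhole[OF ideal_subgrp[OF ideal_dvd[of a]] fin])
      obtain k where k: "n = m + Suc k" using mn(1) less_iff_Suc_add by auto
      have *: "(p ^ k * p - 1) * (p ^ m * b) = (p ^ n - p ^ m) * b"
        by (simp add: k power_add algebra_simps)
      have "a dvd (p ^ n - p ^ m) * b" using mn(2) by simp
      then have "p ^ k * p - 1 \<in> ann (p ^ m * b)" by (simp only: ann_def mem_Collect_eq *)
      then have "p ^ k * p - 1 \<in> P" using pow bP by blast
      then have "1 \<in> P"
        using subgrp_cong[OF ideal_subgrp[OF PI]] ideal_mult[OF PI p] by blast
      then show False using primeideal_one[OF P] by blast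
    qed
    \<comment> \<open>Replacing \<open>b\<close> by \<open>s * b\<close> keeps the annihilator
      inside \<open>P\<close> by primality, hence unchanged by maximality, and the new form visibly
      contains \<open>p\<close>.\<close>
    then obtain s where s: "s \<notin> P" "s \<in> ann (p * b)" by blast
    have "x \<in> P" if "x \<in> ann (s * b)" for x
    proof -
      have "x * s \<in> ann b" using that by (simp add: ann_def mult.assoc)
      then show ?thesis using bP s(1) primeideal_mult[OF P] by blast
    qed
    then have "ann (s * b) = ann b" by (intro max) blast
    moreover have "p \<in> ann (s * b)" using s(2) by (simp add: ann_def algebra_simps)
    ultimately show ?thesis by blast
  qed
  moreover have "\<not> a dvd b"
  proof
    assume "a dvd b"
    then have "1 \<in> ann b" by (simp add: ann_def)
    then show False using bP primeideal_one[OF P] by blast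
  qed
  ultimately show thesis using that[of b] by (auto simp: ann_def)
qed

text \<open>Two of the numerators \<open>x ^ n * a\<close> agree modulo \<open>a\<close>, so \<open>x ^ n - x ^ m\<close> lies in the domain for
  some \<open>m < n\<close>, and \<open>x\<close> is a root of a monic polynomial.\<close>

lemma almost_integral_imp_integral:
  assumes "integrally_closed_domain TYPE('a::idom)" "finite (reps {y :: 'a. a dvd y})" "a \<noteq> 0"
    and "\<And>n. x ^ n * to_fract a \<in> range to_fract"
  shows "x \<in> range to_fract"
proof -
  have "\<forall>n. \<exists>y. x ^ n * to_fract a = to_fract y" using assms(4) by blast
  then obtain f where f: "x ^ n * to_fract a = to_fract (f n)" for n by metis
  obtain m n :: nat where mn: "m < n" "f n - f m \<in> {y. a dvd y}"
    by (rule reps_pigeonhole[OF ideal_subgrp[OF ideal_dvd[of a]] assms(2)])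
  then obtain c where c: "f n - f m = a * c" by (auto elim: dvdE)
  have "(x ^ n - x ^ m) * to_fract a = to_fract (f n - f m)"
    by (simp add: f left_diff_distrib)
  also have "\<dots> = to_fract c * to_fract a" by (simp add: c mult.commute)
  finally have x: "x ^ n - x ^ m = to_fract c" using assms(3) by simp
  define p where "p = monom 1 n + (- monom 1 m - [:c:])"
  have deg: "degree (- monom 1 m - [:c:] :: 'a poly) < n"
    using mn(1) by (intro degree_diff_less) (auto simp: degree_monom_eq)
  then have "degree p = n"
    unfolding p_def by (subst degree_add_eq_left) (auto simp: degree_monom_eq)
  moreover have "coeff p n = 1"
    using coeff_eq_0[OF deg] by (simp add: p_def)
  ultimately have "lead_coeff p = 1" by simp
  moreover have "map_poly to_fract p = monom 1 n - monom 1 m - [:to_fract c:]"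
    by (rule poly_eqI) (auto simp: p_def coeff_map_poly coeff_pCons split: nat.split)
  then have "poly (map_poly to_fract p) x = 0" using x by (simp add: poly_monom)
  ultimately show ?thesis using assms(1) unfolding integrally_closed_domain_def by blast
qed

lemma frac_inverse_one: "1 \<in> frac_inverse I"
  by (auto simp: frac_inverse_def)

text \<open>\<open>J\<close> stands for any ideal containing the products of
  \<open>frac_inverse I\<close> with \<open>I\<close>. The conclusion thus says that these products
  generate the whole ring, and each use chooses the \<open>J\<close> that suits it.\<close>

lemma invertible_ideal:
  assumes ic: "integrally_closed_domain TYPE('a::idom)" and nf: "norm_finite TYPE('a)"
    and I: "ideal I (ring_of_type_algebra :: 'a ring)" "a \<in> I" "a \<noteq> 0"
    and J: "ideal J (ring_of_type_algebra :: 'a ring)"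
    and prod: "\<And>u b y. u \<in> frac_inverse I \<Longrightarrow> b \<in> I \<Longrightarrow> to_fract y = u * to_fract b \<Longrightarrow> y \<in> J"
  shows "1 \<in> J"
proof (rule ccontr)
  assume "1 \<notin> J"
  moreover have aJ: "a \<in> J" using prod[OF frac_inverse_one I(2)] by simp
  ultimately obtain P where P: "primeideal P ring_of_type_algebra" "J \<subseteq> P"
    using exists_prime_above[OF J] norm_finiteD[OF nf J _ I(3)] by blast
  have fin: "finite (reps {x. a dvd x})"
    using norm_finiteD[OF nf ideal_dvd[of a], of a] I(3) by simp
  obtain b where b: "\<not> a dvd b" "\<And>p. p \<in> P \<Longrightarrow> a dvd p * b"
    using prime_annihilator[OF P(1) _ fin] P(2) aJ by blast
  \<comment> \<open>By the choice of \<open>b\<close>, this fraction multiplies \<open>P\<close>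
    into the ring without lying in the ring.\<close>
  define x where "x = to_fract b / to_fract a"
  have xP: "x * to_fract p \<in> range to_fract" if p: "p \<in> P" for p
  proof -
    obtain c where "p * b = a * c" using b(2)[OF p] by (auto elim: dvdE)
    then have "to_fract p * to_fract b = to_fract a * to_fract c"
      by (metis to_fract_mult)
    then have "x * to_fract p = to_fract c" using I(3) by (simp add: x_def field_simps)
    then show ?thesis by blast
  qed
  \<comment> \<open>Multiplication by \<open>u\<close> takes \<open>I\<close> into \<open>J\<close>
    and so into \<open>P\<close>, and \<open>x\<close> takes \<open>P\<close> into the ring. Hence
    \<open>frac_inverse I\<close> is stable under \<open>x\<close>, and all powers of
    \<open>x\<close> have the common denominator \<open>a\<close>.\<close>
  have xV: "x * u \<in> frac_inverse I" if u: "u \<in> frac_inverse I" for u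
    unfolding frac_inverse_def
  proof safe
    fix c assume c: "c \<in> I"
    then obtain y where y: "u * to_fract c = to_fract y" using u by (auto simp: frac_inverse_def)
    then have "y \<in> P" using prod[OF u c] P(2) by auto
    then show "x * u * to_fract c \<in> range to_fract" using xP y by (simp add: mult.assoc)
  qed
  have "x ^ n \<in> frac_inverse I" for n
    by (induction n) (auto simp: frac_inverse_one xV)
  then have "x ^ n * to_fract a \<in> range to_fract" for n
    using I(2) by (auto simp: frac_inverse_def)
  then have "x \<in> range to_fract"
    by (rule almost_integral_imp_integral[OF ic fin I(3)])
  then obtain y where "x = to_fract y" by blast
  then have "to_fract b = to_fract (a * y)" using I(3) by (simp add: x_def field_simps)
  then have "b = a * y" by (simp only: to_fract_eq_iff)
  then show False using b(1) by simp
qed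

section \<open>The projective line over a finite quotient\<close>

text \<open>The determinant with rows \<open>v\<close> and \<open>w\<close>. For vectors that are
  unimodular modulo an ideal, its vanishing modulo that ideal detects that both span the same
  line.\<close>

definition cross :: "'a::comm_ring_1 ^ 2 \<Rightarrow> 'a ^ 2 \<Rightarrow> 'a" where
  "cross v w = v $ 1 * w $ 2 - v $ 2 * w $ 1"

definition vecs :: "'a set \<Rightarrow> ('a ^ 2) set" where
  "vecs I = {v. v $ 1 \<in> I \<and> v $ 2 \<in> I}"

definition adj2 :: "'a::comm_ring_1 ^ 2 ^ 2 \<Rightarrow> 'a ^ 2 ^ 2" where
  "adj2 Q = vector [vector [Q $ 2 $ 2, - Q $ 1 $ 2], vector [- Q $ 2 $ 1, Q $ 1 $ 1]]"

lemma vec2_eq_iff: "v = w \<longleftrightarrow> v $ 1 = w $ 1 \<and> v $ 2 = (w :: 'a ^ 2) $ 2"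
  by (simp add: vec_eq_iff forall_2)

lemma vector_matrix_mult_2: "(v v* Q) $ j = v $ 1 * Q $ 1 $ j + v $ 2 * (Q :: 'a::comm_ring_1 ^ 2 ^ 2) $ 2 $ j"
  by (simp add: vector_matrix_mult_def sum_2 mult.commute)

lemma matrix_matrix_mult_2: "(P ** Q) $ i $ j = P $ i $ 1 * Q $ 1 $ j + P $ i $ 2 * (Q :: 'a::comm_ring_1 ^ 2 ^ 2) $ 2 $ j"
  by (simp add: matrix_matrix_mult_def sum_2)

lemma row_matrix_mult_2: "(P ** Q) $ i = P $ i v* (Q :: 'a::comm_ring_1 ^ 2 ^ 2)"
  by (simp add: vec2_eq_iff vector_matrix_mult_2 matrix_matrix_mult_2)

lemma invertible_if_det_unit:
  fixes Q :: "'a::comm_ring_1 ^ 2 ^ 2"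
  assumes "det Q * u = 1"
  shows "invertible Q"
  unfolding invertible_def
  by (rule exI[of _ "\<chi> i j. u * adj2 Q $ i $ j"])
     (use assms in \<open>auto simp: vec2_eq_iff matrix_matrix_mult_2 adj2_def mat_def det_2 algebra_simps\<close>)

lemma cross_vector_matrix_mult:
  "cross (v v* Q) (w v* Q) = det Q * cross v w"
  by (simp add: cross_def vector_matrix_mult_2 det_2 algebra_simps)

lemma cross_rows: "cross (A $ 1) (A $ 2) = det A"
  by (simp add: cross_def det_2)

lemma cross_swap: "cross w v = - cross v w"
  by (simp add: cross_def algebra_simps)

lemma cross_simps:
  "cross (c *s v) w = c * cross v w" "cross v (c *s w) = c * cross v w"
  "cross (v + v') w = cross v w + cross v' w" "cross v (w + w') = cross v w + cross v w'"
  "cross (v - v') w = cross v w - cross v' w" "cross v (w - w') = cross v w - cross v w'"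
  "cross v v = 0" "cross 0 w = 0" "cross v 0 = 0"
  by (simp_all add: cross_def algebra_simps)

lemma vecs_subgrp: "subgrp I \<Longrightarrow> subgrp (vecs I)"
  by (auto simp: subgrp_def vecs_def)

lemma vecs_vector_matrix_mult:
  "ideal I (ring_of_type_algebra :: 'a::idom ring) \<Longrightarrow> v \<in> vecs I \<Longrightarrow> v v* Q \<in> vecs I"
  by (auto simp: vecs_def vector_matrix_mult_2 intro!: subgrp_add ideal_mult_right ideal_subgrp)

lemma cross_vecs:
  assumes "ideal I (ring_of_type_algebra :: 'a::idom ring)" "v \<in> vecs I"
  shows "cross v w \<in> I" "cross w v \<in> I"
proof -
  have v: "v $ 1 \<in> I" "v $ 2 \<in> I" using assms(2) by (auto simp: vecs_def)
  show "cross v w \<in> I" unfolding cross_def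
    by (intro subgrp_diff ideal_subgrp assms(1) ideal_mult_right v)
  show "cross w v \<in> I" unfolding cross_def
    by (intro subgrp_diff ideal_subgrp assms(1) ideal_mult v)
qed

lemma cross_cong:
  assumes I: "ideal I (ring_of_type_algebra :: 'a::idom ring)"
    and v: "v - v' \<in> vecs I" and w: "w - w' \<in> vecs I"
  shows "cross v w \<in> I \<longleftrightarrow> cross v' w' \<in> I"
proof (rule subgrp_cong[OF ideal_subgrp[OF I]])
  have "cross v w - cross v' w' = cross (v - v') w + cross v' (w - w')"
    by (simp add: cross_simps)
  also have "\<dots> \<in> I" by (intro subgrp_add ideal_subgrp I cross_vecs v w)
  finally show "cross v w - cross v' w' \<in> I" .
qed

lemma bij_betw_reps_vecs:
  assumes "subgrp I"
  shows "bij_betw (\<lambda>v. (rep I (v $ 1), rep I (v $ 2))) (reps (vecs I)) (reps I \<times> reps I)"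
proof (rule bij_betw_imageI)
  note S = vecs_subgrp[OF assms]
  show "inj_on (\<lambda>v. (rep I (v $ 1), rep I (v $ 2))) (reps (vecs I))"
  proof (rule inj_onI)
    fix v w assume "v \<in> reps (vecs I)" "w \<in> reps (vecs I)"
      "(rep I (v $ 1), rep I (v $ 2)) = (rep I (w $ 1), rep I (w $ 2))"
    then show "v = w"
      using reps_inj[OF S, of v w] by (auto simp: rep_eq_iff[OF assms] vecs_def)
  qed
  have "(rep I a, rep I b) \<in> (\<lambda>v. (rep I (v $ 1), rep I (v $ 2))) ` reps (vecs I)" for a b
  proof (rule image_eqI)
    have "rep (vecs I) (vector [a, b]) - vector [a, b] \<in> vecs I" by (rule rep_diff[OF S])
    then show "(rep I a, rep I b) =
        (rep I (rep (vecs I) (vector [a, b]) $ 1), rep I (rep (vecs I) (vector [a, b]) $ 2))"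
      by (simp add: vecs_def rep_eq_iff[OF assms] subgrp_swap[OF assms, of a] subgrp_swap[OF assms, of b])
    show "rep (vecs I) (vector [a, b]) \<in> reps (vecs I)" by (rule rep_mem)
  qed
  then show "(\<lambda>v. (rep I (v $ 1), rep I (v $ 2))) ` reps (vecs I) = reps I \<times> reps I"
    by (auto simp: reps_def)
qed

lemma card_reps_vecs: "subgrp I \<Longrightarrow> card (reps (vecs I)) = card (reps I) ^ 2"
  using bij_betw_same_card[OF bij_betw_reps_vecs] by (simp add: card_cartesian_product power2_eq_square)

lemma finite_reps_vecs: "subgrp I \<Longrightarrow> finite (reps I) \<Longrightarrow> finite (reps (vecs I))"
  using bij_betw_finite[OF bij_betw_reps_vecs] by blast

text \<open>For nonzero \<open>I\<close> of finite index, this makes the entries and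
  \<open>I\<close> generate the unit ideal (\<open>unimodular_coords\<close>). The form with primes
  is the one that \<open>card_reps_avoiding\<close> counts.\<close>

definition unimodular_mod :: "'a::idom set \<Rightarrow> 'a ^ 2 \<Rightarrow> bool" where
  "unimodular_mod I v \<longleftrightarrow> (\<forall>P\<in>prime_ideals_dividing I. v \<notin> vecs P)"

text \<open>For nonzero \<open>I\<close> of finite index, these represent the units of the quotient,
  since a class is a unit exactly when it avoids every prime above \<open>I\<close>.\<close>

definition unit_reps :: "'a::idom set \<Rightarrow> 'a set" where
  "unit_reps I = {x \<in> reps I. \<forall>P\<in>prime_ideals_dividing I. x \<notin> P}"

definition unimodular_reps :: "'a::idom set \<Rightarrow> ('a ^ 2) set" where
  "unimodular_reps I = {v \<in> reps (vecs I). unimodular_mod I v}"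

section \<open>Numbers of units, of unimodular vectors and of vectors on a line\<close>

context
  fixes I :: "'a::idom set" and d :: 'a
  assumes I: "ideal I ring_of_type_algebra" and fin: "finite (reps I)" and d: "d \<in> I" "d \<noteq> 0"
begin

lemma card_unit_reps:
  "real (card (unit_reps I)) =
    real (card (reps I)) * (\<Prod>P\<in>prime_ideals_dividing I. 1 - inverse (real (card (reps P))))"
  unfolding unit_reps_def
proof (rule card_reps_avoiding[OF ideal_subgrp[OF I] fin finite_prime_ideals_dividing[OF I fin d]])
  let ?T = "prime_ideals_dividing I"
  show "subgrp P \<and> I \<subseteq> P" if "P \<in> ?T" for P
    using that primeideal_ideal ideal_subgrp by (auto simp: prime_ideals_dividing_def)
  obtain e where e: "\<And>P. P \<in> ?T \<Longrightarrow> e P - 1 \<in> P"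
      "\<And>P Q. P \<in> ?T \<Longrightarrow> Q \<in> ?T \<Longrightarrow> P \<noteq> Q \<Longrightarrow> e P \<in> Q"
    by (rule prime_chinese_remainder[OF finite_prime_ideals_dividing[OF I fin d]])
       (use prime_dividingD[OF I fin d] in blast)+
  show "\<exists>x. x - c \<in> P \<and> (\<forall>Q\<in>?T - {P}. x \<in> Q)" if P: "P \<in> ?T" for P c
  \<comment> \<open>The witness is \<open>c\<close> modulo \<open>P\<close> and \<open>0\<close>
    modulo the other primes.\<close>
  proof (intro exI[of _ "c * e P"] conjI ballI)
    have "c * (e P - 1) \<in> P"
      using ideal_mult[OF primeideal_ideal e(1)] prime_dividingD(1)[OF I fin d] P by blast
    then show "c * e P - c \<in> P" by (simp add: algebra_simps)
    show "c * e P \<in> Q" if "Q \<in> ?T - {P}" for Q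
      using ideal_mult[OF primeideal_ideal e(2)[OF P]] prime_dividingD(1)[OF I fin d] that by blast
  qed
qed

text \<open>The count of units is repeated in the free module of rank two, with the submodules
  \<open>vecs P\<close>, whose index is the square of that of \<open>P\<close>.\<close>

lemma card_unimodular_reps:
  "real (card (unimodular_reps I)) =
    real (card (reps I) ^ 2) *
      (\<Prod>P\<in>prime_ideals_dividing I. 1 - inverse (real (card (reps P) ^ 2)))"
proof -
  let ?T = "prime_ideals_dividing I"
  have S: "subgrp P" "I \<subseteq> P" if "P \<in> ?T" for P
    using that primeideal_ideal ideal_subgrp by (auto simp: prime_ideals_dividing_def)
  obtain e where e: "\<And>P. P \<in> ?T \<Longrightarrow> e P - 1 \<in> P"
      "\<And>P Q. P \<in> ?T \<Longrightarrow> Q \<in> ?T \<Longrightarrow> P \<noteq> Q \<Longrightarrow> e P \<in> Q"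
    by (rule prime_chinese_remainder[OF finite_prime_ideals_dividing[OF I fin d]])
       (use prime_dividingD[OF I fin d] in blast)+
  have "real (card {v \<in> reps (vecs I). \<forall>S\<in>vecs ` ?T. v \<notin> S}) =
      real (card (reps (vecs I))) * (\<Prod>S\<in>vecs ` ?T. 1 - inverse (real (card (reps S))))"
  proof (rule card_reps_avoiding)
    show "subgrp (vecs I)" "finite (reps (vecs I))" "finite (vecs ` ?T)"
      using vecs_subgrp ideal_subgrp[OF I] finite_reps_vecs fin finite_prime_ideals_dividing[OF I fin d]
      by auto
    show "subgrp S \<and> vecs I \<subseteq> S" if "S \<in> vecs ` ?T" for S
      using that S vecs_subgrp by (fastforce simp: vecs_def)
    show "\<exists>x. x - c \<in> S \<and> (\<forall>S'\<in>vecs ` ?T - {S}. x \<in> S')" if S': "S \<in> vecs ` ?T" for S c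
    proof -
      obtain P where P: "P \<in> ?T" "S = vecs P" using S' by blast
      show ?thesis
      proof (intro exI[of _ "e P *s c"] conjI ballI)
        have PI: "ideal P ring_of_type_algebra"
          using prime_dividingD(1)[OF I fin d P(1)] primeideal_ideal by blast
        have "(e P - 1) * x \<in> P" for x
          using ideal_mult_right[OF PI e(1)[OF P(1)]] .
        then show "e P *s c - c \<in> S" by (simp add: P(2) vecs_def left_diff_distrib)
        show "e P *s c \<in> S'" if S'': "S' \<in> vecs ` ?T - {S}" for S'
        proof -
          obtain Q where Q: "Q \<in> ?T" "S' = vecs Q" "Q \<noteq> P" using S'' P by blast
          have QI: "ideal Q ring_of_type_algebra"
            using prime_dividingD(1)[OF I fin d Q(1)] primeideal_ideal by blast
          have "e P * x \<in> Q" for x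
            using ideal_mult_right[OF QI e(2)[OF P(1) Q(1)]] Q(3) by blast
          then show ?thesis by (simp add: Q(2) vecs_def)
        qed
      qed
    qed
  qed
  \<comment> \<open>Diagonal vectors recover \<open>P\<close> from \<open>vecs P\<close>, so the
    product over submodules can be reindexed by primes.\<close>
  moreover have "inj_on vecs ?T"
  proof (rule inj_onI)
    fix P Q :: "'a set" assume "vecs P = vecs Q"
    then have "vector [x, x] \<in> vecs P \<longleftrightarrow> vector [x, x] \<in> vecs Q" for x by simp
    then show "P = Q" by (auto simp: vecs_def)
  qed
  ultimately show ?thesis
    using S by (simp add: unimodular_reps_def unimodular_mod_def prod.reindex card_reps_vecs
        ideal_subgrp[OF I])
qed

lemma unimodular_mod_cong:
  assumes "v - w \<in> vecs I"
  shows "unimodular_mod I v \<longleftrightarrow> unimodular_mod I w"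
proof -
  have "v \<in> vecs P \<longleftrightarrow> w \<in> vecs P" if "P \<in> prime_ideals_dividing I" for P
  proof (rule subgrp_cong[OF vecs_subgrp])
    show "subgrp P" using that primeideal_ideal ideal_subgrp by (auto simp: prime_ideals_dividing_def)
    show "v - w \<in> vecs P" using assms that by (auto simp: prime_ideals_dividing_def vecs_def)
  qed
  then show ?thesis by (auto simp: unimodular_mod_def)
qed

lemma unimodular_coords:
  assumes "unimodular_mod I v"
  obtains i x y where "i \<in> I" "i + x * v $ 1 + y * v $ 2 = 1"
  by (rule coprime_mod_ideal[OF I fin d, of "v $ 1" "v $ 2"])
     (use assms in \<open>auto simp: unimodular_mod_def vecs_def\<close>)

lemma unimodular_line:
  assumes "unimodular_mod I v" "cross v z \<in> I"
  obtains c where "z - c *s v \<in> vecs I"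
proof -
  obtain i x y where i: "i \<in> I" "i + x * v $ 1 + y * v $ 2 = 1"
    by (rule unimodular_coords[OF assms(1)])
  \<comment> \<open>Pairing \<open>z\<close> with the Bezout coefficients of \<open>v\<close> gives
    the factor; the defect in each entry is a multiple of \<open>i\<close> plus a multiple of
    \<open>cross v z\<close>.\<close>
  let ?c = "x * z $ 1 + y * z $ 2"
  have "z $ 1 - ?c * v $ 1 = z $ 1 * (i + x * v $ 1 + y * v $ 2) - ?c * v $ 1"
    by (simp add: i(2))
  also have "\<dots> = z $ 1 * i + (- y) * cross v z" by (simp add: cross_def algebra_simps)
  also have "\<dots> \<in> I" by (intro subgrp_add ideal_subgrp I ideal_mult i assms)
  finally have 1: "z $ 1 - ?c * v $ 1 \<in> I" .
  have "z $ 2 - ?c * v $ 2 = z $ 2 * (i + x * v $ 1 + y * v $ 2) - ?c * v $ 2"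
    by (simp add: i(2))
  also have "\<dots> = z $ 2 * i + x * cross v z" by (simp add: cross_def algebra_simps)
  also have "\<dots> \<in> I" by (intro subgrp_add ideal_subgrp I ideal_mult i assms)
  finally have "z $ 2 - ?c * v $ 2 \<in> I" .
  then show thesis using that[of ?c] 1 by (simp add: vecs_def)
qed

text \<open>Modulo \<open>I\<close>, the unimodular vectors parallel to \<open>v\<close> are the
  multiples \<open>c *s v\<close> by units \<open>c\<close>, and distinct classes of
  \<open>c\<close> give distinct vectors. As the number does not depend on \<open>v\<close>,
  counting vectors amounts to counting lines.\<close>

lemma card_line:
  assumes v: "unimodular_mod I v"
  shows "card {z \<in> unimodular_reps I. cross v z \<in> I} = card (unit_reps I)"
proof -
  note SI = ideal_subgrp[OF I]
  note SV = vecs_subgrp[OF SI]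
  obtain i x y where i: "i \<in> I" "i + x * v $ 1 + y * v $ 2 = 1"
    by (rule unimodular_coords[OF v])
  have inj: "c - c' \<in> I" if "c *s v - c' *s v \<in> vecs I" for c c'
  proof -
    have *: "(c - c') * v $ 1 \<in> I" "(c - c') * v $ 2 \<in> I"
      using that by (auto simp: vecs_def left_diff_distrib)
    have "c - c' = (c - c') * (i + x * v $ 1 + y * v $ 2)" by (simp add: i(2))
    also have "\<dots> = (c - c') * i + x * ((c - c') * v $ 1) + y * ((c - c') * v $ 2)"
      by (simp add: algebra_simps)
    also have "\<dots> \<in> I" by (rule subgrp_add[OF SI subgrp_add[OF SI]]) (rule ideal_mult[OF I], fact)+
    finally show ?thesis .
  qed
  have smult: "c *s v - c' *s v \<in> vecs I" if "c - c' \<in> I" for c c'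
    using ideal_mult_right[OF I that] by (simp add: vecs_def left_diff_distrib)
  have unim: "unimodular_mod I (c *s v) \<longleftrightarrow> (\<forall>P\<in>prime_ideals_dividing I. c \<notin> P)" for c
  proof -
    have "c *s v \<in> vecs P \<longleftrightarrow> c \<in> P" if P: "P \<in> prime_ideals_dividing I" for P
    proof -
      have PI: "primeideal P ring_of_type_algebra" using prime_dividingD(1)[OF I fin d P] .
      have "v \<notin> vecs P" using v P by (auto simp: unimodular_mod_def)
      then show ?thesis
        using primeideal_mult[OF PI, of c] ideal_mult_right[OF primeideal_ideal[OF PI], of c]
        by (auto simp: vecs_def)
    qed
    then show ?thesis by (auto simp: unimodular_mod_def)
  qed
  have "bij_betw (\<lambda>c. rep (vecs I) (c *s v)) (unit_reps I) {z \<in> unimodular_reps I. cross v z \<in> I}"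
  proof (rule bij_betw_imageI)
    show "inj_on (\<lambda>c. rep (vecs I) (c *s v)) (unit_reps I)"
      using inj reps_inj[OF SI] by (auto intro!: inj_onI simp: rep_eq_iff[OF SV] unit_reps_def)
    show "(\<lambda>c. rep (vecs I) (c *s v)) ` unit_reps I = {z \<in> unimodular_reps I. cross v z \<in> I}"
    proof (intro equalityI subsetI)
      fix z assume "z \<in> (\<lambda>c. rep (vecs I) (c *s v)) ` unit_reps I"
      then obtain c where c: "c \<in> unit_reps I" "z = rep (vecs I) (c *s v)" by blast
      have *: "z - c *s v \<in> vecs I" using c(2) rep_diff[OF SV] by blast
      have "unimodular_mod I z"
        using unimodular_mod_cong[OF *] c(1) unim by (simp add: unit_reps_def)
      moreover have "cross v z \<in> I"
        using cross_cong[OF I _ *, of v v] subgrp_zero[OF SV] subgrp_zero[OF SI]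
        by (simp add: cross_simps)
      ultimately show "z \<in> {z \<in> unimodular_reps I. cross v z \<in> I}"
        using c(2) rep_mem by (auto simp: unimodular_reps_def)
    next
      fix z assume z: "z \<in> {z \<in> unimodular_reps I. cross v z \<in> I}"
      then obtain c where c: "z - c *s v \<in> vecs I" by (auto intro: unimodular_line[OF v])
      have r: "rep I c - c \<in> I" by (rule rep_diff[OF SI])
      have "z - rep I c *s v \<in> vecs I"
        using subgrp_diff[OF SV c smult[OF r]] by simp
      then have *: "rep I c *s v - z \<in> vecs I" using subgrp_swap[OF SV] by blast
      have "unimodular_mod I (rep I c *s v)"
        using unimodular_mod_cong[OF *] z by (simp add: unimodular_reps_def)
      then have "rep I c \<in> unit_reps I" using unim rep_mem by (auto simp: unit_reps_def)
      moreover have "z = rep (vecs I) (rep I c *s v)"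
        using rep_eq_iff[OF SV, of "rep I c *s v" z] * rep_idem[OF SV, of z] z
        by (simp add: unimodular_reps_def)
      ultimately show "z \<in> (\<lambda>c. rep (vecs I) (c *s v)) ` unit_reps I" by blast
    qed
  qed
  then show ?thesis by (rule bij_betw_same_card[symmetric])
qed

end

section \<open>Transitivity of determinant-one matrices on unimodular vectors\<close>

context
  fixes I :: "'a::idom set" and d :: 'a
  assumes nf: "norm_finite TYPE('a)" and I: "ideal I ring_of_type_algebra" and d: "d \<in> I" "d \<noteq> 0"
begin

lemma unimodular_first_row:
  assumes "unimodular_mod I v"
  obtains Q where "det Q = 1" "Q $ 1 - v \<in> vecs I"
proof -
  obtain x y p q where "x - v $ 1 \<in> I" "y - v $ 2 \<in> I" "x * p + y * q = 1"
    by (rule lift_unimodular[OF nf I d, of "v $ 1" "v $ 2"])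
       (use assms in \<open>auto simp: unimodular_mod_def vecs_def\<close>)
  then show thesis
    using that[of "vector [vector [x, y], vector [- q, p]]"] by (simp add: det_2 vecs_def)
qed

lemma unimodular_transitive:
  assumes "unimodular_mod I v" "unimodular_mod I w"
  obtains Q where "det Q = 1" "v v* Q - w \<in> vecs I"
proof -
  obtain R where R: "det R = 1" "R $ 1 - v \<in> vecs I" by (rule unimodular_first_row[OF assms(1)])
  obtain S where S: "det S = 1" "S $ 1 - w \<in> vecs I" by (rule unimodular_first_row[OF assms(2)])
  \<comment> \<open>Since \<open>det R = 1\<close>, \<open>adj2 R\<close> inverts \<open>R\<close>
    and takes its first row to the first unit vector, which \<open>S\<close> takes to its own first
    row.\<close>
  let ?Q = "adj2 R ** S"
  have "det (adj2 R) = 1" using R(1) by (simp add: det_2 adj2_def algebra_simps)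
  then have "det ?Q = 1" by (simp add: det_mul S(1))
  moreover have "R $ 1 v* ?Q = S $ 1"
  proof -
    have "R $ 1 v* adj2 R = det R *s axis 1 1"
      by (simp add: vec2_eq_iff vector_matrix_mult_2 adj2_def det_2 axis_def algebra_simps)
    then have "(R $ 1 v* adj2 R) v* S = S $ 1"
      by (simp add: R(1) vec2_eq_iff vector_matrix_mult_2 axis_def)
    then show ?thesis by (simp add: vector_matrix_mul_assoc)
  qed
  moreover have "(R $ 1 - v) v* ?Q = R $ 1 v* ?Q - v v* ?Q"
    by (simp add: vec2_eq_iff vector_matrix_mult_2 algebra_simps)
  ultimately have "S $ 1 - v v* ?Q \<in> vecs I"
    using vecs_vector_matrix_mult[OF I R(2), of ?Q] by simp
  then have "(S $ 1 - w) - (S $ 1 - v v* ?Q) \<in> vecs I"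
    by (rule subgrp_diff[OF vecs_subgrp[OF ideal_subgrp[OF I]] S(2)])
  then show thesis using that[of ?Q] \<open>det ?Q = 1\<close> by simp
qed

end

section \<open>The stabiliser of the row lattice\<close>

lemma ideal_d1: "ideal (d1 A) (ring_of_type_algebra :: 'a::idom ring)"
  unfolding ideal_iff subgrp_def
proof (intro conjI ballI allI)
  have lin: "A $ 1 $ 1 * w + A $ 1 $ 2 * x + A $ 2 $ 1 * y + A $ 2 $ 2 * z \<in> d1 A" for w x y z
    unfolding d1_def by blast
  show "0 \<in> d1 A" using lin[of 0 0 0 0] by simp
  fix b assume "b \<in> d1 A"
  then obtain w x y z where b: "b = A $ 1 $ 1 * w + A $ 1 $ 2 * x + A $ 2 $ 1 * y + A $ 2 $ 2 * z"
    unfolding d1_def by blast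
  show "r * b \<in> d1 A" for r
    using lin[of "r * w" "r * x" "r * y" "r * z"] by (simp add: b algebra_simps)
  fix c assume "c \<in> d1 A"
  then obtain w' x' y' z'
    where c: "c = A $ 1 $ 1 * w' + A $ 1 $ 2 * x' + A $ 2 $ 1 * y' + A $ 2 $ 2 * z'"
    unfolding d1_def by blast
  show "b - c \<in> d1 A"
    using lin[of "w - w'" "x - x'" "y - y'" "z - z'"] by (simp add: b c algebra_simps)
qed

lemma d1_entry: "A $ i $ j \<in> d1 A"
proof -
  have lin: "A $ 1 $ 1 * w + A $ 1 $ 2 * x + A $ 2 $ 1 * y + A $ 2 $ 2 * z \<in> d1 A" for w x y z
    unfolding d1_def by blast
  show ?thesis
    using lin[of 1 0 0 0] lin[of 0 1 0 0] lin[of 0 0 1 0] lin[of 0 0 0 1] exhaust_2[of i] exhaust_2[of j]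
    by auto
qed

section \<open>Arithmetic of the ideal \<open>f2 A\<close>\<close>

lemma d2_eq: "d2 A = {x. det A dvd x}"
  unfolding d2_def by (rule PIdl_eq)

lemma frac_f2_smult: "s \<in> frac_f2 A \<Longrightarrow> to_fract r * s \<in> frac_f2 A"
  unfolding frac_f2_def frac_mult_def[of "to_fract ` d2 A"]
proof (induction rule: ideal_prod.induct)
  case (prod i j)
  then obtain y where y: "det A dvd y" "i = to_fract y" by (auto simp: d2_eq)
  then have "to_fract (r * y) \<in> to_fract ` d2 A" by (intro imageI) (simp add: d2_eq)
  from ideal_prod.prod[OF this prod(2), of ring_of_type_algebra]
  show ?case by (simp add: y(2) mult.assoc)
next
  case (sum s1 s2)
  from ideal_prod.sum[OF sum(3,4)] show ?case by (simp add: distrib_left)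
qed

lemma frac_f2_mem:
  assumes "u \<in> frac_inverse (d1 A)" "v \<in> frac_inverse (d1 A)"
  shows "to_fract (det A) * (u * v) \<in> frac_f2 A"
proof -
  have "u * v \<in> frac_mult (frac_inverse (d1 A)) (frac_inverse (d1 A))"
    unfolding frac_mult_def using ideal_prod.prod[OF assms, of ring_of_type_algebra] by simp
  moreover have "to_fract (det A) \<in> to_fract ` d2 A" by (auto simp: d2_eq)
  ultimately show ?thesis
    unfolding frac_f2_def frac_mult_def[of "to_fract ` d2 A"]
    using ideal_prod.prod[of "to_fract (det A)" _ "u * v" _ ring_of_type_algebra] by simp
qed

lemma det_in_f2: "det A \<in> f2 A"
  using frac_f2_mem[OF frac_inverse_one frac_inverse_one, of A] by (simp add: f2_def)

lemma f2_mult: "x \<in> f2 A \<Longrightarrow> r * x \<in> f2 A"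
  using frac_f2_smult[of "to_fract x" A r] by (simp add: f2_def)

lemma f2_add: "x \<in> f2 A \<Longrightarrow> y \<in> f2 A \<Longrightarrow> x + y \<in> f2 A"
  unfolding f2_def frac_f2_def frac_mult_def[of "to_fract ` d2 A"]
  using ideal_prod.sum[of "to_fract x" ring_of_type_algebra _ _ "to_fract y"] by simp

lemma ideal_f2: "ideal (f2 A) (ring_of_type_algebra :: 'a::idom ring)"
  unfolding ideal_iff subgrp_def
proof (intro conjI ballI allI)
  show "0 \<in> f2 A" using f2_mult[OF det_in_f2, of 0 A] by simp
  show "x - y \<in> f2 A" if "x \<in> f2 A" "y \<in> f2 A" for x y
    using f2_add[OF that(1) f2_mult[OF that(2), of "- 1"]] by simp
qed (rule f2_mult)

text \<open>Each of the two inverse factors in \<open>f2 A\<close> absorbs one element of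
  \<open>d1 A\<close>, leaving a multiple of the determinant. The inductions follow the two nested
  products of fractional ideals.\<close>

lemma f2_mult_d1_d1:
  assumes "x \<in> f2 A" "a \<in> d1 A" "b \<in> d1 A"
  shows "det A dvd x * a * b"
proof -
  have *: "\<exists>y. s * to_fract (a * b) = to_fract y"
    if "s \<in> frac_mult (frac_inverse (d1 A)) (frac_inverse (d1 A))" for s
    using that unfolding frac_mult_def
  proof (induction rule: ideal_prod.induct)
    case (prod u v)
    obtain y z where "u * to_fract a = to_fract y" "v * to_fract b = to_fract z"
      using prod assms(2,3) unfolding frac_inverse_def by blast
    then have "u * v * to_fract (a * b) = to_fract (y * z)"
      by (simp flip: \<open>u * to_fract a = to_fract y\<close> \<open>v * to_fract b = to_fract z\<close>)
    then show ?case by (intro exI[of _ "y * z"]) simp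
  next
    case (sum s t)
    then obtain y z where "s * to_fract (a * b) = to_fract y" "t * to_fract (a * b) = to_fract z"
      by blast
    then have "(s + t) * to_fract (a * b) = to_fract (y + z)" by (simp add: distrib_right)
    then show ?case by (intro exI[of _ "y + z"]) simp
  qed
  have "\<exists>y. s * to_fract (a * b) = to_fract (det A * y)" if "s \<in> frac_f2 A" for s
    using that unfolding frac_f2_def frac_mult_def[of "to_fract ` d2 A"]
  proof (induction rule: ideal_prod.induct)
    case (prod i j)
    then obtain k where k: "i = to_fract (det A * k)" unfolding d2_eq dvd_def by blast
    obtain y where y: "j * to_fract (a * b) = to_fract y" using *[OF prod(2)] by blast
    have "i * j * to_fract (a * b) = to_fract (det A * (k * y))"
      using y by (simp add: k mult.assoc)
    then show ?case by (intro exI[of _ "k * y"]) simp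
  next
    case (sum s t)
    then obtain y z where "s * to_fract (a * b) = to_fract (det A * y)"
        "t * to_fract (a * b) = to_fract (det A * z)"
      by blast
    then have "(s + t) * to_fract (a * b) = to_fract (det A * (y + z))"
      by (simp add: distrib_right distrib_left)
    then show ?case by (intro exI[of _ "y + z"]) simp
  qed
  then obtain y where "to_fract x * to_fract (a * b) = to_fract (det A * y)"
    using assms(1) unfolding f2_def by blast
  then have "to_fract (x * (a * b)) = to_fract (det A * y)" by simp
  then have "x * (a * b) = det A * y" by (simp only: to_fract_eq_iff)
  then show ?thesis by (simp add: mult.assoc)
qed

text \<open>Cramer's rule: the coordinates of \<open>z\<close> with respect to the rows of
  \<open>A\<close> are, up to sign, the cross products of \<open>z\<close> with these rows divided
  by \<open>det A\<close>.\<close>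

lemma row_span_iff:
  fixes A :: "'a::idom ^ 2 ^ 2"
  assumes "det A \<noteq> 0"
  shows "(\<exists>p. z = p v* A) \<longleftrightarrow> (\<forall>j. det A dvd cross z (A $ j))"
proof
  assume "\<exists>p. z = p v* A"
  then obtain p where p: "z = p v* A" by blast
  have "cross z (A $ 1) = det A * (- p $ 2)" "cross z (A $ 2) = det A * p $ 1"
    by (simp_all add: p cross_def vector_matrix_mult_2 det_2 algebra_simps)
  then show "\<forall>j. det A dvd cross z (A $ j)" by (simp add: forall_2)
next
  assume "\<forall>j. det A dvd cross z (A $ j)"
  then obtain a b where ab: "cross z (A $ 1) = det A * a" "cross z (A $ 2) = det A * b"
    by (meson dvdE)
  have "det A * z $ k = cross z (A $ 2) * A $ 1 $ k - cross z (A $ 1) * A $ 2 $ k" for k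
    using exhaust_2[of k] by (auto simp: cross_def det_2 algebra_simps)
  then have "det A * z $ k = det A * (b * A $ 1 $ k - a * A $ 2 $ k)" for k
    by (simp add: ab algebra_simps)
  then have "z $ k = b * A $ 1 $ k - a * A $ 2 $ k" for k
    using assms by (metis mult_cancel_left)
  then have "z = vector [b, - a] v* A" by (simp add: vec2_eq_iff vector_matrix_mult_2)
  then show "\<exists>p. z = p v* A" by blast
qed

lemma left_multiple_iff:
  fixes A :: "'a::idom ^ 2 ^ 2"
  assumes "det A \<noteq> 0"
  shows "(\<exists>P. B = P ** A) \<longleftrightarrow> (\<forall>i j. det A dvd cross (B $ i) (A $ j))"
proof -
  have "(\<exists>P. B = P ** A) \<longleftrightarrow> (\<forall>i. \<exists>p. B $ i = p v* A)"
  proof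
    assume "\<forall>i. \<exists>p. B $ i = p v* A"
    then obtain p where "\<And>i. B $ i = p i v* A" by metis
    then have "B = (\<chi> i. p i) ** A" by (simp add: vec_eq_iff row_matrix_mult_2)
    then show "\<exists>P. B = P ** A" by blast
  qed (auto simp: row_matrix_mult_2)
  then show ?thesis using row_span_iff[OF assms] by simp
qed

section \<open>Scaled rows and their cross products\<close>

lemma vector_matrix_add: "(v + w) v* Q = v v* Q + w v* (Q :: 'a::comm_ring_1 ^ 2 ^ 2)"
  and vector_matrix_diff: "(v - w) v* Q = v v* Q - w v* Q"
  and vector_matrix_smult: "(c *s v) v* Q = c *s (v v* Q)"
  by (simp_all add: vec2_eq_iff vector_matrix_mult_2 algebra_simps)

lemma cross_combination:
  fixes Q :: "'a::comm_ring_1 ^ 2 ^ 2"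
  shows "cross ((\<Sum>i\<in>T. e i *s s i) v* Q) z = (\<Sum>i\<in>T. e i * cross (s i v* Q) z)"
  by (induction T rule: infinite_finite_induct)
     (auto simp: cross_simps vector_matrix_add vector_matrix_smult)

lemma cross_combination_right:
  "cross z (\<Sum>i\<in>T. e i *s s i) = (\<Sum>i\<in>T. e i * cross z (s i))"
  by (induction T rule: infinite_finite_induct) (auto simp: cross_simps)

text \<open>These vectors span the product of the inverse of \<open>d1 A\<close> with the row
  lattice. Dividing by the content \<open>d1 A\<close> ensures that no prime contains all their
  entries, see \<open>scaled_row_not_in_prime\<close>.\<close>

definition scaled_rows :: "'a::idom ^ 2 ^ 2 \<Rightarrow> ('a ^ 2) set" where
  "scaled_rows A = {s. \<exists>u\<in>frac_inverse (d1 A). \<exists>i. \<forall>k. to_fract (s $ k) = u * to_fract (A $ i $ k)}"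

lemma scaled_row:
  assumes "u \<in> frac_inverse (d1 A)"
  shows "\<exists>s\<in>scaled_rows A. \<forall>k. to_fract (s $ k) = u * to_fract (A $ i $ k)"
proof -
  have "\<forall>k. \<exists>y. to_fract y = u * to_fract (A $ i $ k)"
    using assms d1_entry[of A i] unfolding frac_inverse_def by (metis (mono_tags, lifting) mem_Collect_eq rangeE)
  then obtain y where "\<And>k. to_fract (y k) = u * to_fract (A $ i $ k)" by metis
  then have "\<forall>k. to_fract ((\<chi> k. y k) $ k) = u * to_fract (A $ i $ k)" by simp
  then show ?thesis using assms unfolding scaled_rows_def by blast
qed

lemma to_fract_cross_scaled:
  fixes Q :: "'a::idom ^ 2 ^ 2"
  assumes "\<And>k. to_fract (s $ k) = u * to_fract (v $ k)" "\<And>k. to_fract (t $ k) = u' * to_fract (w $ k)"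
  shows "to_fract (cross (s v* Q) t) = (u * u') * to_fract (cross (v v* Q) w)"
  by (simp add: cross_def vector_matrix_mult_2 assms algebra_simps)

text \<open>Scaling the rows by \<open>u\<close> and \<open>u'\<close> multiplies the cross product
  by \<open>u * u'\<close>, and \<open>det A\<close> times \<open>u * u'\<close> is one of the
  products generating \<open>frac_f2 A\<close>. The way back is
  \<open>det_dvd_cross_if_scaled\<close>.\<close>

lemma cross_scaled_rows:
  assumes "\<And>i j. det A dvd cross (A $ i v* Q) (A $ j)" "s \<in> scaled_rows A" "t \<in> scaled_rows A"
  shows "cross (s v* Q) t \<in> f2 A"
proof -
  obtain u i where u: "u \<in> frac_inverse (d1 A)" "\<And>k. to_fract (s $ k) = u * to_fract (A $ i $ k)"
    using assms(2) unfolding scaled_rows_def by blast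
  obtain u' j where u': "u' \<in> frac_inverse (d1 A)" "\<And>k. to_fract (t $ k) = u' * to_fract (A $ j $ k)"
    using assms(3) unfolding scaled_rows_def by blast
  obtain c where c: "cross (A $ i v* Q) (A $ j) = det A * c" using assms(1) by (meson dvdE)
  have "to_fract (cross (s v* Q) t) = to_fract c * (to_fract (det A) * (u * u'))"
    unfolding to_fract_cross_scaled[OF u(2) u'(2)] c by simp
  also have "\<dots> \<in> frac_f2 A" by (intro frac_f2_smult frac_f2_mem u u')
  finally show ?thesis by (simp add: f2_def)
qed

text \<open>This is the case of the identity matrix, where the cross products of rows are
  \<open>0\<close> or \<open>det A\<close> up to sign. It means that modulo \<open>f2 A\<close> all
  scaled rows are pairwise parallel.\<close>

lemma cross_scaled_rows_self:
  assumes "s \<in> scaled_rows A" "t \<in> scaled_rows A"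
  shows "cross s t \<in> f2 A"
proof -
  have "det A dvd cross (A $ i v* mat 1) (A $ j)" for i j
    using exhaust_2[of i] exhaust_2[of j]
    by (auto simp: cross_simps cross_rows cross_swap[of "A $ 2" "A $ 1"])
  from cross_scaled_rows[OF this assms] show ?thesis by simp
qed

context
  fixes A :: "'a::idom ^ 2 ^ 2"
  assumes ic: "integrally_closed_domain TYPE('a)" and nf: "norm_finite TYPE('a)" and det: "det A \<noteq> 0"
begin

lemma finite_reps_f2: "finite (reps (f2 A))"
  by (rule norm_finiteD[OF nf ideal_f2 det_in_f2 det])

lemma invertible_d1:
  assumes J: "ideal J (ring_of_type_algebra :: 'a ring)"
    and "\<And>u b y. u \<in> frac_inverse (d1 A) \<Longrightarrow> b \<in> d1 A \<Longrightarrow> to_fract y = u * to_fract b \<Longrightarrow> y \<in> J"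
  shows "1 \<in> J"
proof -
  have "A $ 1 $ 1 \<noteq> 0 \<or> A $ 1 $ 2 \<noteq> 0" using det by (auto simp: det_2)
  then obtain k where "A $ 1 $ k \<noteq> 0" by blast
  then show ?thesis
    using invertible_ideal[OF ic nf ideal_d1 d1_entry[of A 1 k] _ J] assms(2) by blast
qed

text \<open>Every \<open>b\<close> in \<open>d1 A\<close> is a combination of entries of
  \<open>A\<close>, so \<open>u * b\<close> is one of entries of scaled rows. Were all these in
  \<open>P\<close>, invertibility of \<open>d1 A\<close> would put \<open>1\<close> into
  \<open>P\<close>.\<close>

lemma scaled_row_not_in_prime:
  assumes P: "primeideal P (ring_of_type_algebra :: 'a ring)"
  shows "\<exists>s\<in>scaled_rows A. s \<notin> vecs P"
proof (rule ccontr)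
  assume "\<not> (\<exists>s\<in>scaled_rows A. s \<notin> vecs P)"
  then have all: "s \<in> vecs P" if "s \<in> scaled_rows A" for s using that by blast
  note PI = primeideal_ideal[OF P]
  have "1 \<in> P"
  proof (rule invertible_d1[OF PI])
    fix u b y assume u: "u \<in> frac_inverse (d1 A)" and b: "b \<in> d1 A" and y: "to_fract y = u * to_fract b"
    obtain p q r t where b: "b = A $ 1 $ 1 * p + A $ 1 $ 2 * q + A $ 2 $ 1 * r + A $ 2 $ 2 * t"
      using b unfolding d1_def by blast
    obtain s1 where s1: "s1 \<in> scaled_rows A" "\<And>k. to_fract (s1 $ k) = u * to_fract (A $ 1 $ k)"
      using scaled_row[OF u, of 1] by blast
    obtain s2 where s2: "s2 \<in> scaled_rows A" "\<And>k. to_fract (s2 $ k) = u * to_fract (A $ 2 $ k)"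
      using scaled_row[OF u, of 2] by blast
    have "to_fract y = to_fract (s1 $ 1 * p + s1 $ 2 * q + s2 $ 1 * r + s2 $ 2 * t)"
      by (simp add: y b s1(2) s2(2) algebra_simps)
    then have "y = s1 $ 1 * p + s1 $ 2 * q + s2 $ 1 * r + s2 $ 2 * t"
      by (simp only: to_fract_eq_iff)
    moreover have "s1 $ 1 \<in> P" "s1 $ 2 \<in> P" "s2 $ 1 \<in> P" "s2 $ 2 \<in> P"
      using all[OF s1(1)] all[OF s2(1)] by (auto simp: vecs_def)
    ultimately show "y \<in> P"
      by (simp add: subgrp_add[OF ideal_subgrp[OF PI]] ideal_mult_right[OF PI])
  qed
  then show False using primeideal_one[OF P] by blast
qed

text \<open>Multiplied by \<open>u * b\<close> and \<open>u' * b'\<close> with \<open>b\<close> and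
  \<open>b'\<close> in \<open>d1 A\<close>, the cross product becomes that of scaled rows times
  \<open>b * b'\<close>, a multiple of \<open>det A\<close> by \<open>f2_mult_d1_d1\<close>.
  Invertibility of \<open>d1 A\<close> removes the two extra factors.\<close>

lemma det_dvd_cross_if_scaled:
  assumes "\<And>s t. s \<in> scaled_rows A \<Longrightarrow> t \<in> scaled_rows A \<Longrightarrow> cross (s v* Q) t \<in> f2 A"
  shows "det A dvd cross (A $ i v* Q) (A $ j)"
proof -
  let ?x = "cross (A $ i v* Q) (A $ j)"
  have ideal: "ideal {z. det A dvd x * z} ring_of_type_algebra" for x :: 'a
    by (auto simp: ideal_iff subgrp_def right_diff_distrib mult.left_commute)
  have *: "det A dvd ?x * y * y'"
    if "u \<in> frac_inverse (d1 A)" "b \<in> d1 A" "to_fract y = u * to_fract b"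
      "u' \<in> frac_inverse (d1 A)" "b' \<in> d1 A" "to_fract y' = u' * to_fract b'" for u b y u' b' y'
  proof -
    obtain s where s: "s \<in> scaled_rows A" "\<And>k. to_fract (s $ k) = u * to_fract (A $ i $ k)"
      using scaled_row[OF \<open>u \<in> frac_inverse (d1 A)\<close>, of i] by blast
    obtain t where t: "t \<in> scaled_rows A" "\<And>k. to_fract (t $ k) = u' * to_fract (A $ j $ k)"
      using scaled_row[OF \<open>u' \<in> frac_inverse (d1 A)\<close>, of j] by blast
    have "to_fract (cross (s v* Q) t * b * b') = to_fract (?x * y * y')"
      by (simp only: to_fract_mult to_fract_cross_scaled[OF s(2) t(2)]
          \<open>to_fract y = u * to_fract b\<close> \<open>to_fract y' = u' * to_fract b'\<close> mult_ac)
    then have "cross (s v* Q) t * b * b' = ?x * y * y'" by (simp only: to_fract_eq_iff)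
    then show ?thesis
      using f2_mult_d1_d1[OF assms[OF s(1) t(1)] \<open>b \<in> d1 A\<close> \<open>b' \<in> d1 A\<close>] by simp
  qed
  \<comment> \<open>\<open>invertible_d1\<close> acts twice: inside it removes \<open>y'\<close>
    while \<open>y\<close> is fixed, outside it removes \<open>y\<close>.\<close>
  have "1 \<in> {z. det A dvd ?x * z}"
  proof (rule invertible_d1[OF ideal])
    fix u b y assume ub: "u \<in> frac_inverse (d1 A)" "b \<in> d1 A" "to_fract y = u * to_fract b"
    have "1 \<in> {z. det A dvd (?x * y) * z}"
      by (rule invertible_d1[OF ideal]) (use *[OF ub] in blast)
    then show "y \<in> {z. det A dvd ?x * z}" by simp
  qed
  then show ?thesis by simp
qed

text \<open>One vector \<open>w\<close> stands for the line of scaled rows modulo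
  \<open>f2 A\<close>: it is a combination of scaled rows, and each scaled row is a multiple of it.
  Bilinearity of \<open>cross\<close> then carries the divisibility condition of
  \<open>left_multiple_iff\<close> to \<open>w\<close> and back.\<close>

lemma exists_stabilised_vector:
  obtains w where "unimodular_mod (f2 A) w"
    "\<And>Q. (\<exists>P. A ** Q = P ** A) \<longleftrightarrow> cross (w v* Q) w \<in> f2 A"
proof -
  let ?I = "f2 A" and ?T = "prime_ideals_dividing (f2 A)"
  note I = ideal_f2[of A] and fin = finite_reps_f2 and d = det_in_f2[of A] det
  note SI = ideal_subgrp[OF I]
  have prime: "primeideal P ring_of_type_algebra" if "P \<in> ?T" for P
    using that by (simp add: prime_ideals_dividing_def)
  have "\<forall>P\<in>?T. \<exists>s. s \<in> scaled_rows A \<and> s \<notin> vecs P"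
    using scaled_row_not_in_prime prime by blast
  then obtain s where s: "\<And>P. P \<in> ?T \<Longrightarrow> s P \<in> scaled_rows A" "\<And>P. P \<in> ?T \<Longrightarrow> s P \<notin> vecs P"
    by (auto dest!: bchoice)
  obtain e where e: "\<And>P. P \<in> ?T \<Longrightarrow> e P - 1 \<in> P"
      "\<And>P Q. P \<in> ?T \<Longrightarrow> Q \<in> ?T \<Longrightarrow> P \<noteq> Q \<Longrightarrow> e P \<in> Q"
    by (rule prime_chinese_remainder[OF finite_prime_ideals_dividing[OF I fin d]])
       (use prime_dividingD[OF I fin d] in blast)+
  \<comment> \<open>The weights make \<open>w\<close> congruent modulo each \<open>P\<close> to the
    scaled row \<open>s P\<close>, which is nonzero there.\<close>
  define w where "w = (\<Sum>P\<in>?T. e P *s s P)"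
  have uni: "unimodular_mod ?I w"
    unfolding unimodular_mod_def
  proof
    fix P assume P: "P \<in> ?T"
    note PI = primeideal_ideal[OF prime[OF P]]
    note SV = vecs_subgrp[OF ideal_subgrp[OF PI]]
    have "w - s P = (e P - 1) *s s P + (\<Sum>Q\<in>?T - {P}. e Q *s s Q)"
      unfolding w_def sum.remove[OF finite_prime_ideals_dividing[OF I fin d] P]
      by (simp add: vector_sub_rdistrib)
    also have "\<dots> \<in> vecs P"
    proof (rule subgrp_add[OF SV _ subgrp_sum[OF SV]])
      show "(e P - 1) *s s P \<in> vecs P"
        using ideal_mult_right[OF PI e(1)[OF P]] by (simp add: vecs_def)
      show "e Q *s s Q \<in> vecs P" if "Q \<in> ?T - {P}" for Q
        using ideal_mult_right[OF PI e(2)[of Q P]] that P by (simp add: vecs_def)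
    qed
    finally show "w \<notin> vecs P" using s(2)[OF P] subgrp_cong[OF SV] by blast
  qed
  \<comment> \<open>Scaled rows are pairwise parallel modulo \<open>f2 A\<close>, hence parallel to
    their combination \<open>w\<close>; taking the identity for the matrix specialises
    \<open>cross_combination\<close>. Unimodularity of \<open>w\<close> then makes each a multiple
    of \<open>w\<close>.\<close>
  have "cross w t \<in> ?I" if "t \<in> scaled_rows A" for t
    using cross_combination[of e s ?T "mat 1" t]
      subgrp_sum[OF SI ideal_mult[OF I cross_scaled_rows_self[OF s(1) that]], of ?T]
    by (simp add: w_def)
  then have line: "\<exists>c. t - c *s w \<in> vecs ?I" if "t \<in> scaled_rows A" for t
    using unimodular_line[OF I fin d uni] that by metis
  have "(\<forall>i j. det A dvd cross (A $ i v* Q) (A $ j)) \<longleftrightarrow> cross (w v* Q) w \<in> ?I" for Q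
  proof
    assume *: "\<forall>i j. det A dvd cross (A $ i v* Q) (A $ j)"
    have "cross (s P v* Q) (s P') \<in> ?I" if "P \<in> ?T" "P' \<in> ?T" for P P'
      using cross_scaled_rows[OF _ s(1) s(1)] * that by blast
    then show "cross (w v* Q) w \<in> ?I"
      unfolding w_def cross_combination cross_combination_right
      by (intro subgrp_sum[OF SI] ideal_mult[OF I])
  next
    assume *: "cross (w v* Q) w \<in> ?I"
    have "cross (t v* Q) t' \<in> ?I" if t: "t \<in> scaled_rows A" "t' \<in> scaled_rows A" for t t'
    proof -
      obtain c c' where c: "t - c *s w \<in> vecs ?I" "t' - c' *s w \<in> vecs ?I"
        using line t by blast
      have "t v* Q - c *s (w v* Q) \<in> vecs ?I"
        using vecs_vector_matrix_mult[OF I c(1), of Q]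
        by (simp add: vector_matrix_diff vector_matrix_smult)
      then have "cross (t v* Q) t' \<in> ?I \<longleftrightarrow> cross (c *s (w v* Q)) (c' *s w) \<in> ?I"
        using c(2) by (rule cross_cong[OF I])
      then show ?thesis using ideal_mult[OF I ideal_mult[OF I *]] by (simp add: cross_simps)
    qed
    then show "\<forall>i j. det A dvd cross (A $ i v* Q) (A $ j)"
      using det_dvd_cross_if_scaled by blast
  qed
  then have "(\<exists>P. A ** Q = P ** A) \<longleftrightarrow> cross (w v* Q) w \<in> ?I" for Q
    using left_multiple_iff[OF det, of "A ** Q"] by (simp add: row_matrix_mult_2)
  then show thesis using that[OF uni] by blast
qed

end

section \<open>Counting right cosets\<close>

lemma GL2_det_unit:
  assumes "Q \<in> GL2"
  obtains u where "det Q * u = 1"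
proof -
  obtain R where "Q ** R = mat 1" using assms by (auto simp: GL2_def invertible_def)
  then have "det Q * det R = 1" by (metis det_mul det_I)
  then show thesis by (rule that)
qed

lemma GL2_if_det_unit: "det Q * u = 1 \<Longrightarrow> Q \<in> GL2"
  by (simp add: GL2_def invertible_if_det_unit)

lemma GL2_mult: "P \<in> GL2 \<Longrightarrow> Q \<in> GL2 \<Longrightarrow> P ** Q \<in> GL2"
  by (simp add: GL2_def invertible_mult)

lemma GL2_inverse:
  assumes "Q \<in> GL2"
  obtains R where "R \<in> GL2" "Q ** R = mat 1" "R ** Q = mat 1"
proof -
  obtain R where "Q ** R = mat 1" "R ** Q = mat 1"
    using assms unfolding GL2_def invertible_def by blast
  moreover from this have "R \<in> GL2" unfolding GL2_def invertible_def by blast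
  ultimately show thesis using that by blast
qed

lemma GL2_one: "mat 1 \<in> GL2"
  by (rule GL2_if_det_unit[of _ 1]) (simp add: det_I)

lemma GL2_right_coset_self: "B \<in> GL2_right_coset B"
  unfolding GL2_right_coset_def using GL2_one by (force intro: exI[of _ "mat 1"])

lemma GL2_right_coset_eq_iff:
  "GL2_right_coset B = GL2_right_coset C \<longleftrightarrow> (\<exists>P\<in>GL2. B = P ** C)"
proof
  assume "GL2_right_coset B = GL2_right_coset C"
  then show "\<exists>P\<in>GL2. B = P ** C" using GL2_right_coset_self[of B] by (auto simp: GL2_right_coset_def)
next
  assume "\<exists>P\<in>GL2. B = P ** C"
  then obtain P where P: "P \<in> GL2" "B = P ** C" by blast
  obtain R where R: "R \<in> GL2" "R ** P = mat 1" by (rule GL2_inverse[OF P(1)])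
  have "Q ** C = (Q ** R) ** B" for Q
    using R(2) by (metis P(2) matrix_mul_assoc matrix_mul_rid)
  moreover have "Q ** B = (Q ** P) ** C" for Q by (simp add: P(2) matrix_mul_assoc)
  ultimately show "GL2_right_coset B = GL2_right_coset C"
    unfolding GL2_right_coset_def using GL2_mult P(1) R(1) by blast
qed

lemma GL2_right_cosets_in_double_coset:
  "{C. (\<exists>B. C = GL2_right_coset B) \<and> C \<subseteq> GL2_double_coset A} = {GL2_right_coset (A ** Q) | Q. Q \<in> GL2}"
proof (intro equalityI subsetI)
  fix C assume "C \<in> {C. (\<exists>B. C = GL2_right_coset B) \<and> C \<subseteq> GL2_double_coset A}"
  then obtain B where B: "C = GL2_right_coset B" "C \<subseteq> GL2_double_coset A" by blast
  then obtain P Q where PQ: "P \<in> GL2" "Q \<in> GL2" "B = P ** A ** Q"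
    using GL2_right_coset_self[of B] by (auto simp: GL2_double_coset_def)
  then have "C = GL2_right_coset (A ** Q)"
    unfolding B(1) GL2_right_coset_eq_iff by (auto simp: matrix_mul_assoc)
  then show "C \<in> {GL2_right_coset (A ** Q) | Q. Q \<in> GL2}" using PQ(2) by blast
next
  fix C assume "C \<in> {GL2_right_coset (A ** Q) | Q. Q \<in> GL2}"
  then obtain Q where Q: "Q \<in> GL2" "C = GL2_right_coset (A ** Q)" by blast
  have "C \<subseteq> GL2_double_coset A"
    unfolding Q(2) GL2_right_coset_def GL2_double_coset_def using Q(1) by (auto simp: matrix_mul_assoc)
  then show "C \<in> {C. (\<exists>B. C = GL2_right_coset B) \<and> C \<subseteq> GL2_double_coset A}" using Q(2) by blast
qed

text \<open>With \<open>R\<close> the inverse of \<open>Q'\<close>, equality of the cosets says that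
  \<open>Q ** R\<close> stabilises the row lattice of \<open>A\<close>, which the hypothesis
  expresses through \<open>w\<close>. Applying \<open>R\<close> to both arguments of
  \<open>cross\<close> changes its value only by a unit.\<close>

lemma right_coset_mult_eq_iff:
  fixes A :: "'a::idom ^ 2 ^ 2"
  assumes det: "det A \<noteq> 0" and I: "ideal I (ring_of_type_algebra :: 'a ring)"
    and w: "\<And>Q. (\<exists>P. A ** Q = P ** A) \<longleftrightarrow> cross (w v* Q) w \<in> I"
    and Q: "Q \<in> GL2" "Q' \<in> GL2"
  shows "GL2_right_coset (A ** Q) = GL2_right_coset (A ** Q') \<longleftrightarrow> cross (w v* Q) (w v* Q') \<in> I"
proof -
  obtain R where R: "R \<in> GL2" "Q' ** R = mat 1" "R ** Q' = mat 1" by (rule GL2_inverse[OF Q(2)])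
  have QR: "Q ** R \<in> GL2" using Q(1) R(1) by (rule GL2_mult)
  have eq: "A ** Q = P ** (A ** Q') \<longleftrightarrow> A ** (Q ** R) = P ** A" for P
  proof
    assume "A ** Q = P ** (A ** Q')"
    then have "A ** Q ** R = P ** (A ** Q') ** R" by simp
    also have "\<dots> = P ** A ** (Q' ** R)" by (simp only: matrix_mul_assoc)
    finally show "A ** (Q ** R) = P ** A" by (simp add: R(2) matrix_mul_assoc)
  next
    assume "A ** (Q ** R) = P ** A"
    then have "A ** (Q ** R) ** Q' = P ** A ** Q'" by simp
    moreover have "A ** (Q ** R) ** Q' = A ** Q ** (R ** Q')" by (simp only: matrix_mul_assoc)
    ultimately show "A ** Q = P ** (A ** Q')" by (simp add: R(3) matrix_mul_assoc)
  qed
  \<comment> \<open>Cancelling \<open>det A\<close> in the determinants gives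
    \<open>det P = det (Q ** R)\<close>, so every such \<open>P\<close> is invertible.\<close>
  have GL: "P \<in> GL2" if "A ** (Q ** R) = P ** A" for P
  proof -
    have "det A * det (Q ** R) = det P * det A" using that by (metis det_mul)
    then have "det P = det (Q ** R)" using det by simp
    then show ?thesis using GL2_det_unit[OF QR] GL2_if_det_unit by metis
  qed
  have "GL2_right_coset (A ** Q) = GL2_right_coset (A ** Q') \<longleftrightarrow> (\<exists>P. A ** (Q ** R) = P ** A)"
    unfolding GL2_right_coset_eq_iff eq using GL by blast
  also have "\<dots> \<longleftrightarrow> cross (w v* (Q ** R)) w \<in> I" by (rule w)
  also have "\<dots> \<longleftrightarrow> cross (w v* Q) (w v* Q') \<in> I"
  proof -
    have "w v* (Q ** R) = (w v* Q) v* R" "w = (w v* Q') v* R"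
      by (simp_all add: vector_matrix_mul_assoc R(2))
    then have c: "cross (w v* (Q ** R)) w = det R * cross (w v* Q) (w v* Q')"
      by (metis cross_vector_matrix_mult)
    obtain u where u: "det R * u = 1" by (rule GL2_det_unit[OF R(1)])
    have "u * (det R * x) = x" for x using u by (metis mult.assoc mult.commute mult_1)
    then show ?thesis unfolding c using ideal_mult[OF I] by metis
  qed
  finally show ?thesis .
qed

lemma unimodular_mod_GL2:
  assumes "unimodular_mod I v" "Q \<in> GL2"
  shows "unimodular_mod I (v v* Q)"
  unfolding unimodular_mod_def
proof
  fix P assume P: "P \<in> prime_ideals_dividing I"
  then have PI: "ideal P ring_of_type_algebra" by (simp add: prime_ideals_dividing_def primeideal_ideal)
  obtain R where R: "Q ** R = mat 1" by (rule GL2_inverse[OF assms(2)])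
  have "(v v* Q) v* R = v" by (simp add: vector_matrix_mul_assoc R)
  then show "v v* Q \<notin> vecs P"
    using vecs_vector_matrix_mult[OF PI, of "v v* Q" R] assms(1) P by (auto simp: unimodular_mod_def)
qed

text \<open>Each unimodular \<open>z\<close> is sent to the coset of \<open>A ** q z\<close>, where
  \<open>q z\<close> moves \<open>w\<close> to \<open>z\<close> modulo \<open>f2 A\<close>. The
  fibres are lines, of the size given by \<open>card_line\<close>, and every coset is reached
  because \<open>w v* Q\<close> is unimodular.\<close>

lemma card_unimodular_reps_eq_mu:
  fixes A :: "'a::idom ^ 2 ^ 2"
  assumes ic: "integrally_closed_domain TYPE('a)" and nf: "norm_finite TYPE('a)" and det: "det A \<noteq> 0"
  shows "card (unimodular_reps (f2 A)) = card (unit_reps (f2 A)) * mu A"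
proof -
  let ?I = "f2 A"
  note I = ideal_f2[of A] and fin = finite_reps_f2[OF ic nf det] and d = det_in_f2[of A] det
  note SI = ideal_subgrp[OF I]
  note SV = vecs_subgrp[OF SI]
  obtain w where w: "unimodular_mod ?I w" "\<And>Q. (\<exists>P. A ** Q = P ** A) \<longleftrightarrow> cross (w v* Q) w \<in> ?I"
    using exists_stabilised_vector[OF ic nf det] by blast
  note coset = right_coset_mult_eq_iff[OF det I w(2)]
  have "\<exists>Q. Q \<in> GL2 \<and> w v* Q - z \<in> vecs ?I" if "unimodular_mod ?I z" for z
    using unimodular_transitive[OF nf I d w(1) that] GL2_if_det_unit[of _ 1] by (metis mult_1_right)
  then obtain q where q: "\<And>z. unimodular_mod ?I z \<Longrightarrow> q z \<in> GL2"
      "\<And>z. unimodular_mod ?I z \<Longrightarrow> w v* q z - z \<in> vecs ?I"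
    by metis
  define g where "g z = GL2_right_coset (A ** q z)" for z
  \<comment> \<open>The matrix \<open>Q\<close> is left general, since the fibres need it for
    \<open>q v\<close> and surjectivity needs it for arbitrary members of
    \<open>GL2\<close>.\<close>
  have g_eq: "GL2_right_coset (A ** Q) = g z \<longleftrightarrow> cross v z \<in> ?I"
    if "Q \<in> GL2" "w v* Q - v \<in> vecs ?I" "unimodular_mod ?I z" for Q v z
    unfolding g_def coset[OF that(1) q(1)[OF that(3)]]
    by (rule cross_cong[OF I that(2) q(2)[OF that(3)]])
  have "card (unimodular_reps ?I) = card (unit_reps ?I) * card (g ` unimodular_reps ?I)"
  proof (rule card_eq_fibres)
    show "finite (unimodular_reps ?I)"
      unfolding unimodular_reps_def using finite_reps_vecs[OF SI fin] by simp
    fix C assume "C \<in> g ` unimodular_reps ?I"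
    then obtain v where v: "C = g v" "unimodular_mod ?I v" by (auto simp: unimodular_reps_def)
    have "g z = C \<longleftrightarrow> cross v z \<in> ?I" if "z \<in> unimodular_reps ?I" for z
      using g_eq[OF q[OF v(2)], of z] that v(1) by (auto simp: unimodular_reps_def g_def)
    then have "{z \<in> unimodular_reps ?I. g z = C} = {z \<in> unimodular_reps ?I. cross v z \<in> ?I}"
      by blast
    then show "card {z \<in> unimodular_reps ?I. g z = C} = card (unit_reps ?I)"
      using card_line[OF I fin d v(2)] by simp
  qed
  also have "g ` unimodular_reps ?I = {GL2_right_coset (A ** Q) | Q. Q \<in> GL2}"
  proof (intro equalityI subsetI)
    fix C assume "C \<in> {GL2_right_coset (A ** Q) | Q. Q \<in> GL2}"
    then obtain Q where Q: "Q \<in> GL2" "C = GL2_right_coset (A ** Q)" by blast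
    let ?z = "rep (vecs ?I) (w v* Q)"
    have r: "?z - w v* Q \<in> vecs ?I" by (rule rep_diff[OF SV])
    have z: "unimodular_mod ?I ?z"
      using unimodular_mod_cong[OF I fin d r] unimodular_mod_GL2[OF w(1) Q(1)] by blast
    have "w v* Q - ?z \<in> vecs ?I" using r subgrp_swap[OF SV] by blast
    then have "C = g ?z"
      using g_eq[OF Q(1) _ z] Q(2) subgrp_zero[OF SI] by (simp add: cross_simps)
    moreover have "?z \<in> unimodular_reps ?I" using z rep_mem by (simp add: unimodular_reps_def)
    ultimately show "C \<in> g ` unimodular_reps ?I" by blast
  qed (use q(1) in \<open>auto simp: g_def unimodular_reps_def\<close>)
  finally show ?thesis
    unfolding mu_def GL2_right_cosets_in_double_coset .
qed

theorem theorem3p8: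
  fixes A :: "'a::idom ^ 2 ^ 2"
  assumes "dedekind_domain TYPE('a)" and "norm_finite TYPE('a)"
    and "det A \<noteq> 0"
  shows "real (mu A) =
    real (ideal_norm (f2 A)) *
      (\<Prod>\<pp>\<in>prime_ideals_dividing (f2 A). 1 + inverse (real (ideal_norm \<pp>)))"
proof -
  let ?I = "f2 A" and ?T = "prime_ideals_dividing (f2 A)"
  have ic: "integrally_closed_domain TYPE('a)" using assms(1) by (simp add: dedekind_domain_def)
  note I = ideal_f2[of A] and fin = finite_reps_f2[OF ic assms(2,3)] and d = det_in_f2[of A] assms(3)
  define q where "q P = inverse (real (card (reps P)))" for P :: "'a set"
  define N where "N = real (card (reps ?I))"
  \<comment> \<open>A prime is proper, so its index is not one; hence the product of the
    \<open>1 - q P\<close> can be cancelled at the end.\<close>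
  have q: "1 - q P \<noteq> 0" if P: "P \<in> ?T" for P
  proof -
    have PI: "primeideal P ring_of_type_algebra" using prime_dividingD(1)[OF I fin d P] .
    have "rep P 1 \<noteq> rep P 0"
      using primeideal_one[OF PI] rep_eq_iff[OF ideal_subgrp[OF primeideal_ideal[OF PI]]] by simp
    then have "card (reps P) \<noteq> 1"
      using rep_mem[of P 0] rep_mem[of P 1] by (auto simp: card_1_singleton_iff)
    then show ?thesis by (simp add: q_def)
  qed
  have "N > 0"
    unfolding N_def using fin rep_mem[of ?I 0] by (auto simp: card_gt_0_iff)
  have nz: "N * (\<Prod>P\<in>?T. 1 - q P) \<noteq> 0"
    using q \<open>N > 0\<close> finite_prime_ideals_dividing[OF I fin d] by simp
  \<comment> \<open>The unimodular vectors are counted in two ways, by lines and by primes.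
    Factoring \<open>1 - (q P) ^ 2\<close> leaves the factors \<open>1 + q P\<close> after
    cancellation.\<close>
  have "N * (\<Prod>P\<in>?T. 1 - q P) * real (mu A) = real (card (unit_reps ?I) * mu A)"
    using card_unit_reps[OF I fin d] by (simp add: N_def q_def)
  also have "\<dots> = real (card (unimodular_reps ?I))"
    using card_unimodular_reps_eq_mu[OF ic assms(2,3)] by simp
  also have "\<dots> = N ^ 2 * (\<Prod>P\<in>?T. 1 - (q P) ^ 2)"
    unfolding card_unimodular_reps[OF I fin d] by (simp add: N_def q_def power_inverse)
  also have "(\<Prod>P\<in>?T. 1 - (q P) ^ 2) = (\<Prod>P\<in>?T. (1 - q P) * (1 + q P))"
    by (rule prod.cong) (simp_all add: power2_eq_square algebra_simps)
  also have "N ^ 2 * \<dots> = N * (\<Prod>P\<in>?T. 1 - q P) * (N * (\<Prod>P\<in>?T. 1 + q P))"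
    by (simp add: prod.distrib power2_eq_square)
  finally have "real (mu A) = N * (\<Prod>P\<in>?T. 1 + q P)"
    using nz mult_left_cancel by blast
  also have "(\<Prod>P\<in>?T. 1 + q P) = (\<Prod>P\<in>?T. 1 + inverse (real (ideal_norm P)))"
    by (rule prod.cong[OF refl])
       (simp add: q_def ideal_norm_eq[OF primeideal_ideal[OF prime_dividingD(1)[OF I fin d]]])
  finally show ?thesis by (simp add: N_def ideal_norm_eq[OF I])
qed

end
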